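(* Let $X$ be a complex Banach space and let $f:\mathbb{R}_+\to X$ be bounded, continuous and Lipschitz continuous. Suppose that the Laplace transform $\widehat{f}$ admits a boundary function $F\in L^1_{\mathrm{loc}}(\mathbb{R};X)$, i.e. $$\lim_{\alpha\to0+}\int_\mathbb{R}\widehat{f}(\alpha+\mathrm{i}s)\psi(s)\,\mathrm{d}s=\int_\mathbb{R}F(s)\psi(s)\,\mathrm{d}s\quad\text{for all }\psi\in C_\mathrm{c}(\mathbb{R}).$$ Then $f\in C_0(\mathbb{R}_+;X)$, i.e. $\|f(t)\|\to0$ as $t\to\infty$. Moreover, let $M:\mathbb{R}_+\to[1,\infty)$ be a continuous non-decreasing function. Then: (a) If $k\ge1$ is an integer, $F\in C^k(\mathbb{R};X)$ and there is a constant $C>0$ such that $\|F^{(j)}(s)\|\le C M(|s|)^{j+1}$ for all $s\in\mathbb{R}$ and $0\le j\le k$, then for every $c>0$, $$\|f(t)\|=O\left(\frac{1}{M_k^{-1}(ct)}\right),\quad t\to\infty,$$ where $M_k^{-1}$ is the inverse of the strictly increasing function $M_k:\mathbb{R}_+\to(0,\infty)$, $M_k(R)=M(R)\big((1+R)^2M(R)\big)^{1/k}$. (b) If $F\in C^\infty(\mathbb{R};X)$ and there is a constant $C>0$ such that $\|F^{(j)}(s)\|\le C\, j!\, M(|s|)^{j+1}$ for all $s\in\mathbb{R}$ and all integers $j\ge0$, then for every $c\in(0,1/2)$, $$\|f(t)\|=O\left(\frac{1}{M_{\log}^{-1}(ct)}\right),\quad t\to\infty,$$ where $M_{\log}^{-1}$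 is the inverse of the strictly increasing function $M_{\log}:\mathbb{R}_+\to(0,\infty)$, $M_{\log}(R)=M(R)\big(\log(1+R)+\log M(R)\big)$.
   Context: For a bounded measurable $f:\mathbb{R}_+\to X$ the Laplace transform is $\widehat{f}(\lambda)=\int_0^\infty \mathrm{e}^{-\lambda t}f(t)\,\mathrm{d}t$ for $\operatorname{Re}\lambda>0$. $C_0(\mathbb{R}_+;X)$ denotes continuous functions vanishing at infinity. The inverses $M_k^{-1}$, $M_{\log}^{-1}$ are defined on the ranges of $M_k$, $M_{\log}$, which contain $ct$ for all sufficiently large $t$. *)

theory Defs
  imports "HOL-Analysis.Analysis" "HOL-Library.Landau_Symbols"
begin

class complex_banach = banach +
  fixes scaleC :: "complex \<Rightarrow> 'a \<Rightarrow> 'a"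
  assumes scaleC_add_right: "scaleC a (x + y) = scaleC a x + scaleC a y"
    and scaleC_add_left: "scaleC (a + b) x = scaleC a x + scaleC b x"
    and scaleC_scaleC: "scaleC a (scaleC b x) = scaleC (a * b) x"
    and scaleC_one: "scaleC 1 x = x"
    and scaleC_of_real: "scaleC (complex_of_real r) x = scaleR r x"
    and norm_scaleC: "norm (scaleC a x) = cmod a * norm x"

text \<open>Laplace transform of f : R_+ -> X (meaningful for Re lambda > 0).\<close>
definition laplace :: "(real \<Rightarrow> 'a::complex_banach) \<Rightarrow> complex \<Rightarrow> 'a" where
  "laplace f z = integral {0..} (\<lambda>t. scaleC (exp (- z * complex_of_real t)) (f t))"

definition Cc :: "(real \<Rightarrow> complex) set" where
  "Cc = {\<psi>. continuous_on UNIV \<psi> \<and> bounded {s. \<psi> s \<noteq> 0}}"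

definition boundary_function :: "(real \<Rightarrow> 'a::complex_banach) \<Rightarrow> (real \<Rightarrow> 'a) \<Rightarrow> bool" where
  "boundary_function f F \<longleftrightarrow>
     (\<forall>a b. F integrable_on {a..b} \<and> (\<lambda>s. norm (F s)) integrable_on {a..b}) \<and>
     (\<forall>\<psi>\<in>Cc. ((\<lambda>\<alpha>. integral UNIV (\<lambda>s. scaleC (\<psi> s) (laplace f (complex_of_real \<alpha> + \<i> * complex_of_real s))))
                 \<longlongrightarrow> integral UNIV (\<lambda>s. scaleC (\<psi> s) (F s))) (at_right 0))"

definition Mk :: "(real \<Rightarrow> real) \<Rightarrow> nat \<Rightarrow> real \<Rightarrow> real" where
  "Mk M k R = M R * ((1 + R)\<^sup>2 * M R) powr (1 / real k)"

definition Mlog :: "(real \<Rightarrow> real) \<Rightarrow> real \<Rightarrow> real" where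
  "Mlog M R = M R * (ln (1 + R) + ln (M R))"

definition admissible_M :: "(real \<Rightarrow> real) \<Rightarrow> bool" where
  "admissible_M M \<longleftrightarrow> continuous_on {0..} M \<and> mono_on {0..} M \<and> (\<forall>R\<ge>0. M R \<ge> 1)"

end

theory Submission
  imports Defs "HOL-Probability.Sinc_Integral"
begin

text \<open>
  Test the boundary function against $(1 - (s/R)^2)_+^2\, e^{ist}$. The Fourier transform of
  $(1 - s^2)_+^2$ has integral $2\pi$ and a finite first absolute moment, so for Lipschitz $f$ the
  resulting average of $f$ around $t$ differs from $2\pi f(t)$ by $O(1/R)$ uniformly in $t \ge 1$; the
  damping $e^{-\alpha t}$ in the Laplace transform is harmless because $e^{-\alpha t} f$ satisfies
  the same bounds uniformly in $\alpha$. Hence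
  $\|f(t)\| \le O(1/R) + \|\int_{-R}^R (1 - (s/R)^2)^2 e^{ist} F(s)\,ds\|$.
  The Riemann--Lebesgue lemma gives convergence to $0$. For the rates, integrate by parts $k$ times;
  the boundary terms are $O(R^{-2})$ since the cutoff vanishes to second order at $\pm R$. In (a) $k$ is the
  given number and $R = M_k^{-1}(ct)$; in (b) $R = M_{\log}^{-1}(ct)$ and $k = \lfloor t/M(R) \rfloor$,
  where Stirling's bound $k!/k^k \le e k e^{-k}$ yields the condition $c < 1/2$.
\<close>

text \<open>The double zero of the cutoff at the endpoints is what lets a Lipschitz hypothesis
  suffice: the Fourier transform then decays like $u^{-3}$, whereas a simple zero would give
  $u^{-2}$ and a divergent first moment. Using a polynomial inside the interval matters in (b),
  where the number $k$ of integrations by parts grows with $t$: its derivatives are bounded by one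
  constant for all orders, so the Leibniz sums stay below a constant times $j!$.

  Write $m = M(R)$. The integral that is left after $k$ steps is of order $R m a_k (m/t)^k$, with
  $a_k$ fixed in (a) and $a_k = k!$ in (b), and it has to be $O(1/R)$. In (a), $M_k(R) = ct$ says
  exactly that $(m/t)^k = c^k / ((1+R)^2 m)$, which outweighs $R^2 m$. In (b), put $e^y = (1+R) m$.
  Then $t/m = y/c$, the cost $R^2 m$ is at most $e^{2y}$, the gain $k!/k^k$ is at most of order $y
  e^{-y/c}$, and the sign of $1/c - 2$ decides.\<close>

section \<open>Vector-valued Henstock--Kurzweil integrals\<close>

text \<open>The error is measured against \<open>norm (F s)\<close>, which may be unbounded, so
  closure under uniform limits would not apply. On a fine division the Riemann sums of
  \<open>G\<close> and \<open>g\<close> differ by at most \<open>e\<close> times a Riemann sum of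
  the norm, and those sums are bounded; so \<open>G\<close> satisfies the Cauchy criterion.\<close>

lemma integrable_on_of_relative_approx:
  fixes G F :: "real \<Rightarrow> 'a::banach"
  assumes nF: "(\<lambda>s. norm (F s)) integrable_on {a..b}"
    and approx: "\<And>e::real. e > 0 \<Longrightarrow> \<exists>g. g integrable_on {a..b} \<and> (\<forall>s\<in>{a..b}. norm (G s - g s) \<le> e * norm (F s))"
  shows "G integrable_on {a..b}"
proof -
  let ?n = "\<lambda>s. norm (F s)"
  define I where "I = integral {a..b} ?n"
  have I0: "I \<ge> 0" unfolding I_def by (intro integral_nonneg nF) auto
  have "\<exists>\<gamma>. gauge \<gamma> \<and> (\<forall>p q. p tagged_division_of cbox a b \<and> \<gamma> fine p \<and> q tagged_division_of cbox a b \<and> \<gamma> fine q \<longrightarrow>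
           norm ((\<Sum>(x, k)\<in>p. measure lborel k *\<^sub>R G x) - (\<Sum>(x, k)\<in>q. measure lborel k *\<^sub>R G x)) < e)" if "e > 0" for e :: real
  proof -
    \<comment> \<open>Once \<open>\<gamma>2\<close> keeps the Riemann sums of the norm below
      \<open>I + 1\<close>, a relative error \<open>d\<close> costs at most
      \<open>d * (I + 1) = e / 4\<close>.\<close>
    define d where "d = e / (4 * (I + 1))"
    have d: "d > 0" using that I0 by (simp add: d_def)
    obtain g where g: "g integrable_on cbox a b" "\<And>s. s \<in> cbox a b \<Longrightarrow> norm (G s - g s) \<le> d * ?n s"
      using approx[OF d] by auto
    have "e/4 > 0" "(1::real) > 0" using that by auto
    from has_integralD[OF integrable_integral[OF g(1)] this(1)]
    obtain \<gamma>1 where \<gamma>1: "gauge \<gamma>1" "\<And>p. p tagged_division_of cbox a b \<Longrightarrow> \<gamma>1 fine p \<Longrightarrow>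
        norm ((\<Sum>(x, k)\<in>p. measure lborel k *\<^sub>R g x) - integral (cbox a b) g) < e/4"
      by metis
    from has_integralD[OF integrable_integral[OF nF[folded box_real(2)]] \<open>(1::real) > 0\<close>]
    obtain \<gamma>2 where \<gamma>2: "gauge \<gamma>2" "\<And>p. p tagged_division_of cbox a b \<Longrightarrow> \<gamma>2 fine p \<Longrightarrow>
        norm ((\<Sum>(x, k)\<in>p. measure lborel k *\<^sub>R ?n x) - I) < 1"
      unfolding I_def box_real by metis
    define \<gamma> where "\<gamma> x = \<gamma>1 x \<inter> \<gamma>2 x" for x
    have close: "norm ((\<Sum>(x, k)\<in>p. measure lborel k *\<^sub>R G x) - integral (cbox a b) g) < e/2"
      if p: "p tagged_division_of cbox a b" "\<gamma> fine p" for p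
    proof -
      have f12: "\<gamma>1 fine p" "\<gamma>2 fine p" using p(2) unfolding \<gamma>_def fine_def by auto
      have "norm ((\<Sum>(x, k)\<in>p. measure lborel k *\<^sub>R G x) - (\<Sum>(x, k)\<in>p. measure lborel k *\<^sub>R g x))
            = norm (\<Sum>(x, k)\<in>p. measure lborel k *\<^sub>R (G x - g x))"
        by (simp add: sum_subtractf[symmetric] split_def scaleR_diff_right)
      also have "\<dots> \<le> (\<Sum>(x, k)\<in>p. measure lborel k * (d * ?n x))"
        unfolding split_def
        by (rule sum_norm_le) (use tagged_division_ofD(2,3)[OF p(1)] g(2) in \<open>auto intro!: mult_left_mono simp del: box_real, blast\<close>)
      also have "\<dots> = d * (\<Sum>(x, k)\<in>p. measure lborel k *\<^sub>R ?n x)"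
        by (simp add: sum_distrib_left split_def mult_ac)
      also have "\<dots> \<le> d * (I + 1)"
        using \<gamma>2(2)[OF p(1) f12(2)] d by (intro mult_left_mono) (auto simp: abs_if split: if_splits)
      also have "\<dots> = e / 4" using I0 by (simp add: d_def field_simps)
      finally have "norm ((\<Sum>(x, k)\<in>p. measure lborel k *\<^sub>R G x) - (\<Sum>(x, k)\<in>p. measure lborel k *\<^sub>R g x)) \<le> e/4" .
      with \<gamma>1(2)[OF p(1) f12(1)] show ?thesis by norm
    qed
    have "gauge \<gamma>" unfolding \<gamma>_def using \<gamma>1(1) \<gamma>2(1) by (rule gauge_Int)
    then show ?thesis
      using close by (intro exI[of _ \<gamma>]) (smt (verit, best) field_sum_of_halves norm_diff_triangle_less norm_minus_commute)
  qed
  then have "G integrable_on cbox a b" unfolding integrable_Cauchy by blast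
  then show ?thesis by simp
qed

text \<open>A continuous multiplier can destroy conditional integrability, so the integrability of
  the norm is essential. Freezing \<open>\<psi>\<close> on short intervals gives integrable
  functions with a small error relative to \<open>norm (F s)\<close>; the pieces are glued by
  bisection.\<close>

lemma integrable_on_continuous_scaleR:
  fixes F :: "real \<Rightarrow> 'a::banach"
  assumes F: "F integrable_on {a..b}" and nF: "(\<lambda>s. norm (F s)) integrable_on {a..b}"
    and \<psi>: "continuous_on {a..b} \<psi>"
  shows "(\<lambda>s. \<psi> s *\<^sub>R F s) integrable_on {a..b}"
proof (cases "a \<le> b")
  case True
  show ?thesis
  proof (rule integrable_on_of_relative_approx[OF nF])
    fix e :: real assume e: "e > 0"
    \<comment> \<open>The guard makes \<open>P\<close> vacuous on intervals that leave
      \<open>{a..b}\<close>, which the local hypothesis of \<open>Bolzano\<close> also ranges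
      over.\<close>
    define P where "P u v \<longleftrightarrow> (a \<le> u \<and> v \<le> b \<longrightarrow> (\<exists>g. g integrable_on {u..v} \<and> (\<forall>s\<in>{u..v}. norm (\<psi> s *\<^sub>R F s - g s) \<le> e * norm (F s))))" for u v
    have "P a b"
    proof (rule Bolzano[OF True, of P])
      fix u v w assume uvw: "P u v" "P v w" "u \<le> v" "v \<le> w"
      show "P u w" unfolding P_def
      proof
        assume uw: "a \<le> u \<and> w \<le> b"
        obtain g1 where g1: "g1 integrable_on {u..v}" "\<And>s. s\<in>{u..v} \<Longrightarrow> norm (\<psi> s *\<^sub>R F s - g1 s) \<le> e * norm (F s)"
          using uvw uw unfolding P_def by auto
        obtain g2 where g2: "g2 integrable_on {v..w}" "\<And>s. s\<in>{v..w} \<Longrightarrow> norm (\<psi> s *\<^sub>R F s - g2 s) \<le> e * norm (F s)"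
          using uvw uw unfolding P_def by auto
        define g where "g s = (if s \<le> v then g1 s else g2 s)" for s
        have "g integrable_on {u..v}"
          using g1(1) by (rule integrable_eq) (auto simp: g_def)
        moreover have "g integrable_on {v..w}"
          using g2(1) by (rule integrable_spike[of _ _ "{v}"]) (auto simp: g_def)
        ultimately have "g integrable_on {u..w}" using uvw(3,4)
          by (meson Henstock_Kurzweil_Integration.integrable_combine)
        then show "\<exists>g. g integrable_on {u..w} \<and> (\<forall>s\<in>{u..w}. norm (\<psi> s *\<^sub>R F s - g s) \<le> e * norm (F s))"
          using g1(2) g2(2) by (intro exI[of _ g]) (auto simp: g_def)
      qed
    next
      fix x assume x: "a \<le> x" "x \<le> b"
      then obtain d where d: "d > 0" "\<And>y. y \<in> {a..b} \<Longrightarrow> dist y x < d \<Longrightarrow> dist (\<psi> y) (\<psi> x) < e"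
        using \<psi> e unfolding continuous_on_iff by (metis atLeastAtMost_iff)
      have "P u v" if uv: "u \<le> x" "x \<le> v" "v - u < d" for u v
        unfolding P_def
      proof (intro impI exI[of _ "\<lambda>s. \<psi> x *\<^sub>R F s"] conjI ballI)
        assume "a \<le> u \<and> v \<le> b"
        then show "(\<lambda>s. \<psi> x *\<^sub>R F s) integrable_on {u..v}"
          by (intro integrable_cmul integrable_on_subinterval[OF F]) auto
        fix s assume "s \<in> {u..v}"
        then have "\<bar>\<psi> s - \<psi> x\<bar> \<le> e"
          using d(2)[of s] uv \<open>a \<le> u \<and> v \<le> b\<close> by (auto simp: dist_real_def abs_less_iff)
        then show "norm (\<psi> s *\<^sub>R F s - \<psi> x *\<^sub>R F s) \<le> e * norm (F s)"
          by (simp add: scaleR_diff_left[symmetric] mult_right_mono)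
      qed
      then show "\<exists>d>0. \<forall>u v. u \<le> x \<and> x \<le> v \<and> v - u < d \<longrightarrow> P u v"
        using d(1) by blast
    qed
    then show "\<exists>g. g integrable_on {a..b} \<and> (\<forall>s\<in>{a..b}. norm (\<psi> s *\<^sub>R F s - g s) \<le> e * norm (F s))"
      unfolding P_def by auto
  qed
qed auto

section \<open>Truncation and averages over uniform grids\<close>

lemma integral_uniform_grid:
  fixes f :: "real \<Rightarrow> 'a::banach"
  assumes "f integrable_on {a..a + real N * h}" "h \<ge> 0"
  shows "integral {a..a + real N * h} f = (\<Sum>i<N. integral {a + real i * h..a + real i * h + h} f)"
  using assms(1)
proof (induction N)
  case (Suc N)
  have le: "a + real N * h \<le> a + real (Suc N) * h" "0 \<le> real N * h"
    using assms(2) by (auto simp: algebra_simps)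
  have "integral {a..a + real (Suc N) * h} f
      = integral {a..a + real N * h} f + integral {a + real N * h..a + real (Suc N) * h} f"
    using Suc.prems le by (intro Henstock_Kurzweil_Integration.integral_combine[symmetric]) auto
  also have "integral {a..a + real N * h} f = (\<Sum>i<N. integral {a + real i * h..a + real i * h + h} f)"
    using le by (intro Suc.IH integrable_on_subinterval[OF Suc.prems]) auto
  finally show ?case by (simp add: algebra_simps)
qed simp

lemma integrable_min_const:
  fixes g :: "real \<Rightarrow> real"
  assumes "g integrable_on {a..b}" "\<And>x. x \<in> {a..b} \<Longrightarrow> g x \<ge> 0"
  shows "(\<lambda>x. min (g x) c) integrable_on {a..b}"
proof -
  have "g absolutely_integrable_on {a..b}" "(\<lambda>x. c) absolutely_integrable_on {a..b}"
    using assms by (auto intro: nonnegative_absolutely_integrable_1)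
  from absolutely_integrable_min[OF this] show ?thesis
    by (auto dest: set_lebesgue_integral_eq_integral)
qed

text \<open>Truncating \<open>g\<close> at a high level leaves an excess \<open>q\<close> of small
  integral, by dominated convergence. The splitting into a bounded part and a small part controls
  integrals of \<open>g\<close> over sets of small measure.\<close>

lemma uniform_integrability:
  fixes g :: "real \<Rightarrow> real"
  assumes g: "g integrable_on {a..b}" "\<And>x. x \<in> {a..b} \<Longrightarrow> g x \<ge> 0" and e: "e > 0"
  obtains m q where "m \<ge> 0" "q integrable_on {a..b}" "\<And>x. x \<in> {a..b} \<Longrightarrow> q x \<ge> 0"
    "\<And>x. x \<in> {a..b} \<Longrightarrow> g x \<le> m + q x" "integral {a..b} q < e"
proof -
  have "(\<lambda>n. integral {a..b} (\<lambda>x. min (g x) (real n))) \<longlonglongrightarrow> integral {a..b} g"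
  proof (rule dominated_convergence(2))
    show "(\<lambda>x. min (g x) (real n)) integrable_on {a..b}" for n
      using g by (rule integrable_min_const)
    show "norm (min (g x) (real n)) \<le> g x" if "x \<in> {a..b}" for n x
      using g(2)[OF that] by (auto simp: min_def)
    show "(\<lambda>n. min (g x) (real n)) \<longlonglongrightarrow> g x" for x
    proof (rule tendsto_eventually)
      obtain n0 where "g x \<le> real n0" using real_arch_simple by blast
      then show "\<forall>\<^sub>F n in sequentially. min (g x) (real n) = g x"
        unfolding eventually_sequentially by (intro exI[of _ n0]) (auto simp: min_def)
    qed
  qed (rule g(1))
  from LIMSEQ_D[OF this e] obtain n where
    n: "norm (integral {a..b} (\<lambda>x. min (g x) (real n)) - integral {a..b} g) < e" by auto
  show ?thesis
  proof (rule that[of "real n" "\<lambda>x. g x - min (g x) (real n)"])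
    show "(\<lambda>x. g x - min (g x) (real n)) integrable_on {a..b}"
      using g by (intro integrable_diff integrable_min_const)
    have "integral {a..b} (\<lambda>x. g x - min (g x) (real n)) = integral {a..b} g - integral {a..b} (\<lambda>x. min (g x) (real n))"
      using g by (intro integral_diff integrable_min_const)
    then show "integral {a..b} (\<lambda>x. g x - min (g x) (real n)) < e"
      using n by (auto simp: abs_if split: if_splits)
  qed auto
qed

text \<open>Each interval is shorter than \<open>r\<close>, hence inside the ball around its tag, so
  the selected intervals form a fine partial division and Henstock's lemma applies. The offsets
  \<open>u\<close> and \<open>v\<close> are free so that the same tags can serve for whole cells and
  for parts of cells.\<close>

lemma Henstock_uniform_grid:
  fixes F :: "real \<Rightarrow> 'a::banach"
  assumes F: "F integrable_on cbox a b" and e: "e > 0" and \<gamma>: "gauge \<gamma>"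
    and fine: "\<And>p. p tagged_division_of cbox a b \<Longrightarrow> \<gamma> fine p \<Longrightarrow>
        norm ((\<Sum>(x, k)\<in>p. measure lborel k *\<^sub>R F x) - integral (cbox a b) F) < e"
    and uv: "0 \<le> u" "u < v" "v \<le> h" and r: "h < r" and A: "a \<le> A" "A + real N * h \<le> b"
    and y: "\<And>J. J \<in> S \<Longrightarrow> J < N \<and> y J \<in> {A + real J * h + u..A + real J * h + v} \<and> ball (y J) r \<subseteq> \<gamma> (y J)"
  shows "norm (\<Sum>J\<in>S. (v - u) *\<^sub>R F (y J) - integral {A + real J * h + u..A + real J * h + v} F) \<le> e"
proof -
  define L where "L J = {A + real J * h + u..A + real J * h + v}" for J
  define p where "p = (\<lambda>J. (y J, L J)) ` S"
  have S: "finite S" using y by (meson finite_nat_iff_bounded lessThan_iff subsetI)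
  have h: "h > 0" using uv by linarith
  have step: "A + real J * h + v \<le> A + real J' * h + u" if "J < J'" for J J'
  proof -
    have "real J * h + h \<le> real J' * h"
      using that h mult_right_mono[of "real J + 1" "real J'" h] by (simp add: algebra_simps)
    then show ?thesis using uv by linarith
  qed
  have disj: "interior (L J) \<inter> interior (L J') = {}" if "J \<noteq> J'" for J J'
    using that step[of J J'] step[of J' J] by (cases "J < J'") (auto simp: L_def)
  have neq: "L J \<noteq> L J'" if "J \<noteq> J'" for J J'
    using that step[of J J'] step[of J' J] uv by (cases "J < J'") (auto simp: L_def Icc_eq_Icc)
  have inj: "inj_on (\<lambda>J. (y J, L J)) S" using neq by (auto simp: inj_on_def)
  have part: "p tagged_partial_division_of cbox a b"
    unfolding tagged_partial_division_of_def
  proof (intro conjI allI impI)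
    show "finite p" unfolding p_def using S by simp
  next
    fix x K assume "(x, K) \<in> p"
    then obtain J where J: "J \<in> S" "x = y J" "K = L J" by (auto simp: p_def)
    show "x \<in> K" using J y by (auto simp: L_def)
    have "real J * h + h \<le> real N * h"
      using y[OF J(1)] h mult_right_mono[of "real J + 1" "real N" h] by (simp add: algebra_simps)
    then have "A + real J * h + v \<le> b" using A uv by linarith
    moreover have "0 \<le> real J * h" using h by simp
    then have "a \<le> A + real J * h + u" using A uv by linarith
    ultimately show "K \<subseteq> cbox a b" using J by (simp add: L_def)
    show "\<exists>a b. K = cbox a b" using J by (auto simp: L_def)
  next
    fix x1 K1 x2 K2 assume "(x1, K1) \<in> p \<and> (x2, K2) \<in> p \<and> (x1, K1) \<noteq> (x2, K2)"
    then obtain J J' where "K1 = L J" "K2 = L J'" "J \<noteq> J'" by (auto simp: p_def)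
    then show "interior K1 \<inter> interior K2 = {}" using disj by simp
  qed
  have "\<gamma> fine p"
    unfolding fine_def p_def
  proof clarify
    fix J x assume J: "J \<in> S" "x \<in> L J"
    then have "x \<in> ball (y J) r" using y[OF J(1)] uv r by (auto simp: L_def dist_real_def)
    then show "x \<in> \<gamma> (y J)" using y[OF J(1)] by auto
  qed
  from Henstock_lemma_part1[OF F e \<gamma> fine part this]
  have "norm (\<Sum>(x,K)\<in>p. measure lborel K *\<^sub>R F x - integral K F) \<le> e" .
  also have "(\<Sum>(x,K)\<in>p. measure lborel K *\<^sub>R F x - integral K F)
      = (\<Sum>J\<in>S. (v - u) *\<^sub>R F (y J) - integral {A + real J * h + u..A + real J * h + v} F)"
    unfolding p_def by (subst sum.reindex[OF inj]) (use uv in \<open>auto simp: L_def intro!: sum.cong\<close>)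
  finally show ?thesis .
qed

text \<open>
  A Henstock--Kurzweil integrable function with integrable norm need not be strongly measurable, so it
  cannot be approximated in norm by continuous functions and the usual proofs of the
  Riemann--Lebesgue lemma do not apply. The substitute: two intervals that meet the set where the gauge is at
  least $1/n$ may share a tag, so Henstock's lemma compares the averages over an interval and
  over a part of it. The remaining intervals lie in the complement of the closure of that set,
  an open set of small measure.
\<close>

lemma uniform_subinterval_average:
  fixes F :: "real \<Rightarrow> 'a::banach"
  assumes F: "F integrable_on {a..b}" and nF: "(\<lambda>s. norm (F s)) integrable_on {a..b}" and "\<epsilon> > 0"
  obtains \<eta> where "\<eta> > 0"
    "\<And>A h N u \<theta>. \<lbrakk>0 < h; h < \<eta>; a \<le> A; A + real N * h \<le> b; 0 \<le> u; 0 < \<theta>; u + \<theta> * h \<le> h\<rbrakk> \<Longrightarrow>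
      norm (\<Sum>J<N. integral {A + real J * h + u..A + real J * h + (u + \<theta> * h)} F
               - \<theta> *\<^sub>R integral {A + real J * h..A + real J * h + h} F) \<le> \<epsilon>"
proof -
  \<comment> \<open>The cells with a tag contribute \<open>2 * e\<close>, the others
    \<open>4 * e\<close>.\<close>
  define e where "e = \<epsilon> / 6"
  have e: "e > 0" using assms by (simp add: e_def)
  let ?g = "\<lambda>s. norm (F s)"
  obtain m q where m: "m \<ge> 0" and q: "q integrable_on {a..b}" "\<And>x. x \<in> {a..b} \<Longrightarrow> q x \<ge> 0"
    and gq: "\<And>x. x \<in> {a..b} \<Longrightarrow> ?g x \<le> m + q x" and qe: "integral {a..b} q < e"
    using uniform_integrability[OF nF _ e] by auto
  from has_integralD[OF integrable_integral[OF F[folded box_real(2)]] e]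
  obtain \<gamma> where \<gamma>: "gauge \<gamma>" "\<And>p. p tagged_division_of cbox a b \<Longrightarrow> \<gamma> fine p \<Longrightarrow>
        norm ((\<Sum>(x, k)\<in>p. measure lborel k *\<^sub>R F x) - integral (cbox a b) F) < e"
    by metis
  \<comment> \<open>Every point of \<open>{a..b}\<close> lies in \<open>E n\<close> for all large
    \<open>n\<close>. Since \<open>E n\<close> itself may fail to be measurable, its closure is
    removed; the rest \<open>U n\<close> is measurable and its measure tends to 0.\<close>
  define E where "E n = {x \<in> {a..b}. ball x (1 / real (Suc n)) \<subseteq> \<gamma> x}" for n
  define U where "U n = {a..b} - closure (E n)" for n
  define w where "w n = indicat_real (U n)" for n
  have clE: "closure (E n) \<subseteq> {a..b}" for n
    by (rule closure_minimal) (auto simp: E_def)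
  have Um: "U n \<in> lmeasurable" for n
  proof -
    have "compact (closure (E n))" using clE by (meson bounded_closed_interval bounded_subset closed_closure compact_eq_bounded_closed)
    then show ?thesis unfolding U_def by (intro fmeasurable.Diff lmeasurable_compact compact_Icc)
  qed
  have wint: "w n integrable_on {a..b}" for n
  proof -
    have "(indicat_real (U n) has_integral measure lebesgue (U n)) UNIV"
      using Um by (simp add: lmeasurable_iff_has_integral)
    then show ?thesis unfolding w_def by (meson integrable_on_subinterval has_integral_integrable subset_UNIV)
  qed
  have "(\<lambda>n. integral {a..b} (w n)) \<longlonglongrightarrow> integral {a..b} (\<lambda>x. 0)"
  proof (rule dominated_convergence(2)[OF wint])
    show "(\<lambda>x. 1::real) integrable_on {a..b}" by auto
    show "norm (w n x) \<le> 1" for n x by (auto simp: w_def indicator_def)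
    fix x assume x: "x \<in> {a..b}"
    from \<gamma>(1) obtain r where r: "r > 0" "ball x r \<subseteq> \<gamma> x"
      unfolding gauge_def by (meson open_contains_ball)
    obtain n0 where n0: "1 / real (Suc n0) < r" using r(1) nat_approx_posE by blast
    have "w n x = 0" if "n \<ge> n0" for n
    proof -
      have "1 / real (Suc n) \<le> 1 / real (Suc n0)" using that by (intro divide_left_mono) auto
      then have "ball x (1 / real (Suc n)) \<subseteq> \<gamma> x" using r(2) n0 by (meson less_imp_le order_trans subset_ball)
      then have "x \<in> E n" using x by (simp add: E_def)
      then show ?thesis using closure_subset[of "E n"] by (auto simp: w_def U_def)
    qed
    then show "(\<lambda>n. w n x) \<longlonglongrightarrow> 0" by (intro tendsto_eventually) (auto simp: eventually_sequentially)
  qed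
  moreover have "e / (m + 1) > 0" using e m by simp
  ultimately obtain n where n: "norm (integral {a..b} (w n) - integral {a..b} (\<lambda>x. 0)) < e / (m + 1)"
    by (blast dest: LIMSEQ_D)
  \<comment> \<open>On cells without a tag \<open>norm (F s)\<close> is at most
    \<open>m + q s\<close>. There the constant \<open>m\<close> is charged to the measure of
    \<open>U n\<close>, so the integral of \<open>Q\<close> pays for both summands.\<close>
  define Q where "Q x = q x + m * w n x" for x
  have w0: "w n x \<ge> 0" for x by (simp add: w_def)
  have Qint: "Q integrable_on {a..b}" unfolding Q_def using q wint by (intro integrable_add integrable_on_mult_right)
  have Q0: "Q x \<ge> 0" if "x \<in> {a..b}" for x unfolding Q_def using q(2)[OF that] m w0 by simp
  have Qe: "integral {a..b} Q \<le> 2 * e"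
  proof -
    have "integral {a..b} Q = integral {a..b} q + m * integral {a..b} (w n)"
      unfolding Q_def using q wint by (subst integral_add) (auto intro: integrable_on_mult_right)
    also have "m * integral {a..b} (w n) \<le> m * (e / (m + 1))"
      using n m by (intro mult_left_mono) auto
    also have "\<dots> \<le> e" using m e by (simp add: field_simps)
    finally show ?thesis using qe by linarith
  qed
  show ?thesis
  \<comment> \<open>Cells shorter than this are fine for the gauge as soon as their tag lies in
    \<open>E n\<close>.\<close>
  proof (rule that[of "1 / real (Suc n)"])
    fix A h N u \<theta>
    assume h: "0 < h" "h < 1 / real (Suc n)" and A: "a \<le> A" "A + real N * h \<le> b"
      and u: "0 \<le> u" "0 < \<theta>" "u + \<theta> * h \<le> h"
    define I where "I J = {A + real J * h..A + real J * h + h}" for J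
    define K where "K J = {A + real J * h + u..A + real J * h + (u + \<theta> * h)}" for J
    have \<theta>h: "\<theta> * h > 0" using h u by simp
    have \<theta>1: "\<theta> \<le> 1"
    proof (rule ccontr)
      assume "\<not> \<theta> \<le> 1"
      then have "\<theta> * h > 1 * h" using h by (intro mult_strict_right_mono) auto
      then show False using u by linarith
    qed
    have KI: "K J \<subseteq> I J" for J using u by (auto simp: I_def K_def)
    have Iab: "I J \<subseteq> {a..b}" if "J < N" for J
    proof -
      have "real J * h + h \<le> real N * h"
        using that h mult_right_mono[of "real J + 1" "real N" h] by (simp add: algebra_simps)
      then have "A + real J * h + h \<le> b" using A by linarith
      moreover have "0 \<le> real J * h" using h by simp
      then have "a \<le> A + real J * h" using A by linarith
      ultimately show ?thesis by (simp add: I_def)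
    qed
    define S where "S = {J. J < N \<and> K J \<inter> E n \<noteq> {}}"
    define B where "B = {..<N} - S"
    have SB: "{..<N} = S \<union> B" "S \<inter> B = {}" "finite S" "finite B" by (auto simp: S_def B_def)
    have "\<forall>J\<in>S. \<exists>y. y \<in> K J \<inter> E n" by (auto simp: S_def)
    \<comment> \<open>Taken from the part \<open>K J\<close>, the tag is admissible both for
      \<open>K J\<close> and for the whole cell \<open>I J\<close>.\<close>
    then obtain y where y: "\<And>J. J \<in> S \<Longrightarrow> y J \<in> K J \<inter> E n" by metis
    have 1: "norm (\<Sum>J\<in>S. (\<theta> * h) *\<^sub>R F (y J) - integral (K J) F) \<le> e"
    proof -
      have "norm (\<Sum>J\<in>S. (u + \<theta> * h - u) *\<^sub>R F (y J) - integral {A + real J * h + u..A + real J * h + (u + \<theta> * h)} F) \<le> e"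
        using y u h A \<theta>h
        by (intro Henstock_uniform_grid[OF F[folded box_real(2)] e \<gamma>, where h = h and r = "1 / real (Suc n)" and N = N])
           (auto simp: E_def K_def S_def)
      then show ?thesis by (simp add: K_def)
    qed
    have 2: "norm (\<Sum>J\<in>S. h *\<^sub>R F (y J) - integral (I J) F) \<le> e"
    proof -
      have "norm (\<Sum>J\<in>S. (h - 0) *\<^sub>R F (y J) - integral {A + real J * h + 0..A + real J * h + h} F) \<le> e"
        using y u h A KI
        by (intro Henstock_uniform_grid[OF F[folded box_real(2)] e \<gamma>, where h = h and r = "1 / real (Suc n)" and N = N])
           (fastforce simp: E_def S_def I_def)+
      then show ?thesis by (simp add: I_def)
    qed
    let ?D = "\<lambda>J. integral (K J) F - \<theta> *\<^sub>R integral (I J) F"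
    have "(\<Sum>J\<in>S. ?D J) = \<theta> *\<^sub>R (\<Sum>J\<in>S. h *\<^sub>R F (y J) - integral (I J) F) - (\<Sum>J\<in>S. (\<theta> * h) *\<^sub>R F (y J) - integral (K J) F)"
      by (simp add: scaleR_sum_right sum_subtractf[symmetric] scaleR_diff_right)
    also have "norm \<dots> \<le> norm (\<theta> *\<^sub>R (\<Sum>J\<in>S. h *\<^sub>R F (y J) - integral (I J) F)) + norm (\<Sum>J\<in>S. (\<theta> * h) *\<^sub>R F (y J) - integral (K J) F)"
      by (rule norm_triangle_ineq4)
    also have "norm (\<theta> *\<^sub>R (\<Sum>J\<in>S. h *\<^sub>R F (y J) - integral (I J) F)) \<le> 1 * e"
      unfolding norm_scaleR using 2 u \<theta>1 by (intro mult_mono) auto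
    finally have good: "norm (\<Sum>J\<in>S. ?D J) \<le> 2 * e" using 1 by linarith
    \<comment> \<open>Both terms cost at most \<open>m * (\<theta> * h)\<close> plus the integral of
      \<open>q\<close>: the weight \<open>\<theta>\<close> reduces the length \<open>h\<close> of
      the cell to the length of its part. So it is enough that the part alone misses
      \<open>E n\<close>.\<close>
    have bad1: "norm (?D J) \<le> 2 * integral (I J) Q" if J: "J \<in> B" for J
    proof -
      have JN: "J < N" and KE: "K J \<inter> E n = {}" using J by (auto simp: B_def S_def)
      note II = integrable_on_subinterval[OF _ Iab[OF JN, unfolded I_def], folded I_def]
      have KK: "f integrable_on K J" if "f integrable_on {a..b}" for f :: "real \<Rightarrow> real"
        using integrable_on_subinterval[OF that, of "A + real J * h + u" "A + real J * h + (u + \<theta> * h)"] Iab[OF JN] KI[of J] unfolding K_def by blast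
      have KKF: "F integrable_on K J"
        using integrable_on_subinterval[OF F, of "A + real J * h + u" "A + real J * h + (u + \<theta> * h)"] Iab[OF JN] KI[of J] unfolding K_def by blast
      have gqI: "?g x \<le> m + q x" if "x \<in> I J" for x using gq subsetD[OF Iab[OF JN] that] by blast
      have gqK: "?g x \<le> m + q x" if "x \<in> K J" for x using gqI subsetD[OF KI that] by blast
      \<comment> \<open>The closure of \<open>E n\<close> may touch \<open>K J\<close> at its
        endpoints; only the open interior is surely disjoint from it, hence the spike at two points
        below.\<close>
      have "interior (K J) \<inter> closure (E n) = {}"
        using KE by (metis Int_commute open_Int_closure_eq_empty open_interior interior_subset disjoint_iff subsetD)
      then have wK: "w n x = 1" if "x \<in> interior (K J)" for x
        using that subsetD[OF Iab[OF JN]] subsetD[OF KI] subsetD[OF interior_subset] unfolding w_def U_def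
        by (intro indicator_simps(1)) blast
      have mK: "\<theta> * h = integral (K J) (w n)"
      proof -
        have "integral (K J) (w n) = integral (K J) (\<lambda>x. 1)"
          by (rule integral_spike[of "{A + real J * h + u, A + real J * h + (u + \<theta> * h)}"])
             (use wK in \<open>auto simp: K_def\<close>)
        then show ?thesis using \<theta>h by (simp add: K_def)
      qed
      have sub: "integral (K J) f \<le> integral (I J) f" if "f integrable_on {a..b}" "\<And>x. x \<in> {a..b} \<Longrightarrow> f x \<ge> 0" for f :: "real \<Rightarrow> real"
        using KI KK[OF that(1)] II[OF that(1)] that(2) Iab[OF JN] by (intro integral_subset_le) auto
      have "norm (integral (K J) F) \<le> integral (K J) (\<lambda>x. m + q x)"
        using KKF KK[OF q(1)] gqK by (intro integral_norm_bound_integral integrable_add) (auto simp: K_def)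
      also have "\<dots> = m * (\<theta> * h) + integral (K J) q"
        using KK[OF q(1)] \<theta>h by (subst integral_add) (auto simp: K_def)
      also have "\<dots> \<le> m * (\<theta> * h) + integral (I J) q" using sub[OF q] by simp
      finally have a1: "norm (integral (K J) F) \<le> m * (\<theta> * h) + integral (I J) q" .
      have q0: "integral (I J) q \<ge> 0" using II[OF q(1)] q(2) Iab[OF JN] by (intro integral_nonneg) auto
      have "norm (integral (I J) F) \<le> integral (I J) (\<lambda>x. m + q x)"
        using II[OF F] II[OF q(1)] gqI by (intro integral_norm_bound_integral integrable_add) (auto simp: I_def)
      also have "\<dots> = m * h + integral (I J) q"
        using II[OF q(1)] h by (subst integral_add) (auto simp: I_def)
      finally have "\<theta> * norm (integral (I J) F) \<le> \<theta> * (m * h + integral (I J) q)" using u by simp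
      also have "\<dots> \<le> m * (\<theta> * h) + 1 * integral (I J) q"
        using mult_right_mono[OF \<theta>1 q0] by (simp add: algebra_simps)
      finally have a2: "\<theta> * norm (integral (I J) F) \<le> m * (\<theta> * h) + integral (I J) q" by simp
      have "m * (\<theta> * h) \<le> m * integral (I J) (w n)"
        unfolding mK using sub[OF wint w0] m by (intro mult_left_mono) auto
      moreover have "integral (I J) Q = integral (I J) q + m * integral (I J) (w n)"
        unfolding Q_def using II[OF q(1)] II[OF wint] by (subst integral_add) (auto intro: integrable_on_mult_right)
      moreover have "norm (?D J) \<le> norm (integral (K J) F) + \<theta> * norm (integral (I J) F)"
        using norm_triangle_ineq4[of "integral (K J) F" "\<theta> *\<^sub>R integral (I J) F"] u by simp
      ultimately show ?thesis using a1 a2 by linarith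
    qed
    have IQ0: "integral (I J) Q \<ge> 0" if "J < N" for J
      using integrable_on_subinterval[OF Qint Iab[OF that, unfolded I_def], folded I_def] Q0 Iab[OF that] by (intro integral_nonneg) auto
    have "norm (\<Sum>J\<in>B. ?D J) \<le> (\<Sum>J\<in>B. 2 * integral (I J) Q)"
      using bad1 by (intro sum_norm_le) auto
    also have "\<dots> \<le> (\<Sum>J<N. 2 * integral (I J) Q)"
      using IQ0 by (intro sum_mono2) (auto simp: B_def)
    also have "\<dots> = 2 * integral {A..A + real N * h} Q"
      using integral_uniform_grid[OF integrable_on_subinterval[OF Qint], of A N h] A h
      by (simp add: sum_distrib_left I_def)
    also have "integral {A..A + real N * h} Q \<le> integral {a..b} Q"
      using A Qint Q0 by (intro integral_subset_le integrable_on_subinterval[OF Qint]) auto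
    finally have "norm (\<Sum>J\<in>B. ?D J) \<le> 4 * e" using Qe by linarith
    moreover have "(\<Sum>J<N. ?D J) = (\<Sum>J\<in>S. ?D J) + (\<Sum>J\<in>B. ?D J)"
      using SB by (simp add: sum.union_disjoint)
    ultimately have "norm (\<Sum>J<N. ?D J) \<le> 6 * e"
      using good norm_triangle_ineq[of "\<Sum>J\<in>S. ?D J" "\<Sum>J\<in>B. ?D J"] by simp
    then show "norm (\<Sum>J<N. integral {A + real J * h + u..A + real J * h + (u + \<theta> * h)} F
               - \<theta> *\<^sub>R integral {A + real J * h..A + real J * h + h} F) \<le> \<epsilon>"
      by (simp add: e_def I_def K_def)
  qed simp
qed

section \<open>The Riemann--Lebesgue lemma\<close>

text \<open>Cut each period of \<open>w (t * s)\<close> into \<open>r\<close> equal parts. On the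
  \<open>l\<close>-th part the multiplier is nearly a constant that is the same in all periods, and
  for large \<open>t\<close> the \<open>l\<close>-th parts together carry about \<open>1 / r\<close>
  of the integral of \<open>F\<close>. What remains is that integral times the mean of the
  constants, which is close to the mean 0 of \<open>w\<close>.\<close>

lemma Riemann_Lebesgue_periodic:
  fixes F :: "real \<Rightarrow> 'a::banach" and w :: "real \<Rightarrow> real"
  assumes F: "F integrable_on {a..b}" and nF: "(\<lambda>s. norm (F s)) integrable_on {a..b}"
    and per: "\<And>x. w (x + 2 * pi) = w x"
    and lip: "\<And>x y. \<bar>w x - w y\<bar> \<le> \<bar>x - y\<bar>" and bd: "\<And>x. \<bar>w x\<bar> \<le> 1"
    and mean: "\<And>x. (w has_integral 0) {x..x + 2 * pi}"
  shows "((\<lambda>t. integral {a..b} (\<lambda>s. w (t * s) *\<^sub>R F s)) \<longlongrightarrow> 0) at_top"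
proof (cases "a \<le> b")
  case ab: True
  \<comment> \<open>The last period may stick out beyond \<open>b\<close>; extending by zero up to
    \<open>b + 1\<close> leaves room, since periods are shorter than 1 for
    \<open>t > 2 * pi\<close>.\<close>
  define F0 where "F0 s = (if s \<in> {a..b} then F s else 0)" for s
  have F0: "F0 integrable_on {a..b+1}"
    unfolding F0_def using F has_integral_restrict[of "{a..b}" "{a..b+1}" F] by (auto simp: integrable_on_def)
  have "(\<lambda>s. norm (F0 s)) = (\<lambda>s. if s \<in> {a..b} then norm (F s) else 0)" by (auto simp: F0_def)
  then have nF0: "(\<lambda>s. norm (F0 s)) integrable_on {a..b+1}"
    using nF has_integral_restrict[of "{a..b}" "{a..b+1}" "\<lambda>s. norm (F s)"] by (auto simp: integrable_on_def)
  define G where "G = integral {a..b+1} (\<lambda>s. norm (F0 s))"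
  have G0: "G \<ge> 0" unfolding G_def by (intro integral_nonneg nF0) auto
  have perN: "w (x + real J * (2 * pi)) = w x" for x J
  proof (induction J)
    case (Suc J)
    have "w (x + real (Suc J) * (2 * pi)) = w ((x + real J * (2 * pi)) + 2 * pi)" by (simp add: algebra_simps)
    then show ?case using per Suc by simp
  qed simp
  have cont: "continuous_on S (\<lambda>s. w (t * s))" for t S
  proof -
    have "continuous_on UNIV w" unfolding continuous_on_iff dist_real_def
      using lip by (meson le_less_trans)
    then show ?thesis by (rule continuous_on_compose2) (auto intro: continuous_intros)
  qed
  show ?thesis
    unfolding tendsto_iff dist_norm
  proof (intro allI impI)
    fix \<epsilon> :: real assume \<epsilon>: "\<epsilon> > 0"
    obtain r :: nat where r2: "(4 * pi) * (G + 1) / (\<epsilon> / 2) < real r"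
      using reals_Archimedean2 by blast
    have "(4 * pi) * (G + 1) / (\<epsilon> / 2) > 0" using \<epsilon> G0 by simp
    then have r: "r > 0" "(4 * pi) * (G + 1) / (\<epsilon> / 2) < real r" using r2 by (auto intro: gr0I)
    have r': "2 * (2 * pi / r) * G < \<epsilon> / 2"
    proof -
      have "(4 * pi) * (G + 1) < \<epsilon> / 2 * r" using r \<epsilon> by (simp add: field_simps)
      moreover have "(4 * pi) * G \<le> (4 * pi) * (G + 1)" by simp
      ultimately have "(4 * pi) * G < \<epsilon> / 2 * r" by linarith
      then show ?thesis using r by (simp add: field_simps)
    qed
    have \<epsilon>r: "\<epsilon> / (2 * r) > 0" using \<epsilon> r by simp
    obtain \<eta> where \<eta>: "\<eta> > 0" and avg:
      "\<And>A h N u \<theta>. \<lbrakk>0 < h; h < \<eta>; a \<le> A; A + real N * h \<le> b + 1; 0 \<le> u; 0 < \<theta>; u + \<theta> * h \<le> h\<rbrakk> \<Longrightarrow>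
      norm (\<Sum>J<N. integral {A + real J * h + u..A + real J * h + (u + \<theta> * h)} F0
               - \<theta> *\<^sub>R integral {A + real J * h..A + real J * h + h} F0) \<le> \<epsilon> / (2 * r)"
      by (rule uniform_subinterval_average[OF F0 nF0 \<epsilon>r]) (rule that; blast)
    have "norm (integral {a..b} (\<lambda>s. w (t * s) *\<^sub>R F s) - 0) < \<epsilon>"
      if t: "t > 2 * pi / \<eta>" "t > 2 * pi" for t
    proof -
      have t0: "t > 0" using t(2) pi_gt_zero by linarith
      define h where "h = 2 * pi / t"
      have h: "h > 0" "h < \<eta>" "h < 1" using t \<eta> t0 by (auto simp: h_def field_simps)
      have th: "t * h = 2 * pi" using t0 by (simp add: h_def)
      define N where "N = nat \<lceil>(b - a) / h\<rceil>"
      have N1: "real N * h \<ge> b - a"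
      proof -
        have "(b - a) / h \<le> real N" unfolding N_def by (rule real_nat_ceiling_ge)
        then show ?thesis using h by (simp add: field_simps)
      qed
      have N2: "a + real N * h \<le> b + 1"
      proof -
        have "real N \<le> (b - a) / h + 1" unfolding N_def using ab h
          by (simp add: of_nat_nat of_int_ceiling_le_add_one)
        then have "real N * h \<le> ((b - a) / h + 1) * h" using h by (intro mult_right_mono) auto
        also have "\<dots> = b - a + h" using h by (simp add: field_simps)
        finally show ?thesis using h by linarith
      qed
      define H where "H s = w (t * s) *\<^sub>R F0 s" for s
      have H: "H integrable_on {a..b+1}"
        unfolding H_def by (rule integrable_on_continuous_scaleR[OF F0 nF0 cont])
      have eq: "integral {a..b} (\<lambda>s. w (t * s) *\<^sub>R F s) = integral {a..a + real N * h} H"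
      proof -
        have "H = (\<lambda>s. if s \<in> {a..b} then w (t * s) *\<^sub>R F s else 0)" by (auto simp: H_def F0_def)
        moreover have "{a..b} \<inter> {a..a + real N * h} = {a..b}" using N1 by auto
        ultimately show ?thesis by (simp only: integral_restrict_Int)
      qed
      define K where "K J l = {a + real J * h + real l * (h / r)..a + real J * h + real l * (h / r) + h / r}" for J l
      define I where "I J = {a + real J * h..a + real J * h + h}" for J
      have Ito: "I J \<subseteq> {a..b+1}" if "J < N" for J
      proof -
        have "real J * h + h \<le> real N * h"
          using that h mult_right_mono[of "real J + 1" "real N" h] by (simp add: algebra_simps)
        then have "a + real J * h + h \<le> b + 1" using N2 by linarith
        moreover have "0 \<le> real J * h" using h by simp
        then have "a \<le> a + real J * h" by linarith
        ultimately show ?thesis by (simp add: I_def)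
      qed
      have KI: "K J l \<subseteq> I J" if "l < r" for J l
      proof -
        have "real l * (h / r) + h / r = (real l + 1) * h / r" using r by (simp add: field_simps)
        also have "\<dots> \<le> real r * h / r" using that h by (intro divide_right_mono mult_right_mono) auto
        finally have "real l * (h / r) + h / r \<le> h" using r by simp
        moreover have "0 \<le> real l * (h / r)" using h by simp
        ultimately show ?thesis unfolding K_def I_def by (intro atLeastatMost_subset_iff[THEN iffD2]) linarith
      qed
      have gridI: "integral {a..a + real N * h} f = (\<Sum>J<N. integral (I J) f)"
        if "f integrable_on {a..b+1}" for f :: "real \<Rightarrow> 'b::banach"
        using integral_uniform_grid[OF integrable_on_subinterval[OF that], of a N h] N2 h by (simp add: I_def)
      have gridK: "integral (I J) f = (\<Sum>l<r. integral (K J l) f)"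
        if "f integrable_on {a..b+1}" "J < N" for J and f :: "real \<Rightarrow> 'b::banach"
      proof -
        have "f integrable_on {a + real J * h..(a + real J * h) + real r * (h / r)}"
          using integrable_on_subinterval[OF that(1) Ito[OF that(2), unfolded I_def]] r by simp
        from integral_uniform_grid[OF this] show ?thesis using h r by (simp add: I_def K_def)
      qed
      have intK: "f integrable_on K J l" if "f integrable_on {a..b+1}" "J < N" "l < r" for J l and f :: "real \<Rightarrow> 'b::banach"
        using integrable_on_subinterval[OF that(1)] Ito[OF that(2)] KI[OF that(3)] unfolding K_def by blast
      \<comment> \<open>Sampled at the left end of the \<open>l\<close>-th part of the first period;
        periodicity makes the value valid in every period.\<close>
      define \<alpha> where "\<alpha> l = w (t * (a + real l * (h / r)))" for l
      have near: "\<bar>w (t * s) - \<alpha> l\<bar> \<le> 2 * pi / r" if s: "s \<in> K J l" for s J l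
      proof -
        have "w (t * s) = w ((t * s - real J * (2 * pi)) + real J * (2 * pi))" by simp
        also have "\<dots> = w (t * s - real J * (2 * pi))" by (rule perN)
        also have "t * s - real J * (2 * pi) = t * (s - real J * h)" using th by (simp add: algebra_simps)
        finally have "\<bar>w (t * s) - \<alpha> l\<bar> \<le> \<bar>t * (s - real J * h) - t * (a + real l * (h / r))\<bar>"
          unfolding \<alpha>_def using lip by simp
        also have "t * (s - real J * h) - t * (a + real l * (h / r)) = t * (s - (a + real J * h + real l * (h / r)))"
          by (simp add: algebra_simps)
        also have "\<bar>\<dots>\<bar> = t * \<bar>s - (a + real J * h + real l * (h / r))\<bar>"
          using t0 by (simp add: abs_mult)
        also have "\<dots> \<le> t * (h / r)" using s t0 by (intro mult_left_mono) (auto simp: K_def)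
        finally show ?thesis using th by simp
      qed
      define V where "V = (\<Sum>J<N. integral (I J) F0)"
      define D where "D l = (\<Sum>J<N. integral (K J l) F0 - (1 / r) *\<^sub>R integral (I J) F0)" for l
      have e1: "norm (integral (K J l) H - \<alpha> l *\<^sub>R integral (K J l) F0) \<le> 2 * pi / r * integral (K J l) (\<lambda>s. norm (F0 s))"
        if "J < N" "l < r" for J l
      proof -
        note ii = intK[OF _ that]
        have "integral (K J l) H - \<alpha> l *\<^sub>R integral (K J l) F0 = integral (K J l) (\<lambda>s. H s - \<alpha> l *\<^sub>R F0 s)"
          using ii[OF H] ii[OF F0] by (subst integral_diff) (auto intro: integrable_cmul)
        also have "norm \<dots> \<le> integral (K J l) (\<lambda>s. 2 * pi / r * norm (F0 s))"
        proof (rule integral_norm_bound_integral)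
          show "(\<lambda>s. H s - \<alpha> l *\<^sub>R F0 s) integrable_on K J l"
            using ii[OF H] ii[OF F0] by (intro integrable_diff integrable_cmul)
          show "(\<lambda>s. 2 * pi / r * norm (F0 s)) integrable_on K J l"
            using ii[OF nF0] by (intro integrable_on_mult_right)
          show "norm (H s - \<alpha> l *\<^sub>R F0 s) \<le> 2 * pi / r * norm (F0 s)" if "s \<in> K J l" for s
            using mult_right_mono[OF near[OF that], of "norm (F0 s)"] by (simp add: H_def flip: scaleR_diff_left)
        qed
        finally show ?thesis by simp
      qed
      have "norm (integral {a..a + real N * h} H - (\<Sum>J<N. \<Sum>l<r. \<alpha> l *\<^sub>R integral (K J l) F0))
          = norm (\<Sum>J<N. \<Sum>l<r. integral (K J l) H - \<alpha> l *\<^sub>R integral (K J l) F0)"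
        using gridK[OF H] by (simp add: gridI[OF H] sum_subtractf)
      also have "\<dots> \<le> (\<Sum>J<N. \<Sum>l<r. 2 * pi / r * integral (K J l) (\<lambda>s. norm (F0 s)))"
        using e1 by (intro sum_norm_le) auto
      also have "\<dots> = 2 * pi / r * integral {a..a + real N * h} (\<lambda>s. norm (F0 s))"
        using gridK[OF nF0] by (simp add: gridI[OF nF0] sum_distrib_left)
      also have "\<dots> \<le> 2 * pi / r * G"
        unfolding G_def using N2 nF0 by (intro mult_left_mono integral_subset_le integrable_on_subinterval[OF nF0]) auto
      finally have p1: "norm (integral {a..a + real N * h} H - (\<Sum>J<N. \<Sum>l<r. \<alpha> l *\<^sub>R integral (K J l) F0)) \<le> 2 * pi / r * G" .
      have split: "(\<Sum>J<N. \<Sum>l<r. \<alpha> l *\<^sub>R integral (K J l) F0) = (\<Sum>l<r. \<alpha> l *\<^sub>R D l) + ((\<Sum>l<r. \<alpha> l) / r) *\<^sub>R V"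
      proof -
        have "(\<Sum>J<N. \<Sum>l<r. \<alpha> l *\<^sub>R integral (K J l) F0) = (\<Sum>l<r. \<Sum>J<N. \<alpha> l *\<^sub>R integral (K J l) F0)"
          by (rule sum.swap)
        also have "\<dots> = (\<Sum>l<r. \<alpha> l *\<^sub>R D l + (\<alpha> l / r) *\<^sub>R V)"
          by (intro sum.cong refl)
             (simp add: D_def V_def sum_subtractf scaleR_sum_right scaleR_diff_right)
        finally show ?thesis by (simp add: sum.distrib sum_divide_distrib scaleR_sum_left)
      qed
      have D: "norm (D l) \<le> \<epsilon> / (2 * r)" if "l < r" for l
      proof -
        have "real l * (h / r) + (1 / r) * h = (real l + 1) * h / r" using r by (simp add: field_simps)
        also have "\<dots> \<le> real r * h / r" using that h by (intro divide_right_mono mult_right_mono) auto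
        finally have "real l * (h / r) + (1 / r) * h \<le> h" using r by simp
        from avg[OF h(1,2) order_refl N2 _ _ this] show ?thesis
          using h r by (simp add: D_def K_def I_def add.assoc)
      qed
      have "norm (\<Sum>l<r. \<alpha> l *\<^sub>R D l) \<le> (\<Sum>l<r. \<epsilon> / (2 * r))"
      proof (rule sum_norm_le)
        fix l assume "l \<in> {..<r}"
        then have "\<bar>\<alpha> l\<bar> * norm (D l) \<le> 1 * (\<epsilon> / (2 * r))"
          using D bd by (intro mult_mono) (auto simp: \<alpha>_def)
        then show "norm (\<alpha> l *\<^sub>R D l) \<le> \<epsilon> / (2 * r)" by simp
      qed
      then have p2: "norm (\<Sum>l<r. \<alpha> l *\<^sub>R D l) \<le> \<epsilon> / 2" using r by (simp add: field_simps)
      have mean_h: "((\<lambda>s. w (t * s)) has_integral 0) {a..a + h}"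
      proof -
        have "(w has_integral 0) (cbox (t * a) (t * (a + h)))"
          using mean[of "t * a"] th by (simp add: distrib_left)
        from has_integral_affinity[OF this, of t 0] show ?thesis
          using t0 by (simp add: image_mult_atLeastAtMost_if divide_simps)
      qed
      \<comment> \<open>The samples form a left Riemann sum of \<open>w\<close> over one period, and
        the integral over that period is 0.\<close>
      have \<alpha>: "\<bar>(\<Sum>l<r. \<alpha> l) / r\<bar> \<le> 2 * pi / r"
      proof -
        have wi: "(\<lambda>s. w (t * s)) integrable_on K 0 l" for l
          unfolding K_def by (intro integrable_continuous_interval cont)
        have "0 = (\<Sum>l<r. integral (K 0 l) (\<lambda>s. w (t * s)))"
          using integral_uniform_grid[of "\<lambda>s. w (t * s)" a r "h / r"] r h mean_h
          by (auto simp: K_def integral_unique has_integral_integrable)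
        then have "(\<Sum>l<r. \<alpha> l) / r * h = (\<Sum>l<r. \<alpha> l * (h / r) - integral (K 0 l) (\<lambda>s. w (t * s)))"
          by (simp add: sum_subtractf flip: sum_distrib_right sum_divide_distrib)
        also have "\<bar>\<dots>\<bar> \<le> (\<Sum>l<r. 2 * pi / r * (h / r))"
        proof (rule order_trans[OF sum_abs] , rule sum_mono)
          fix l
          have "\<alpha> l * (h / r) - integral (K 0 l) (\<lambda>s. w (t * s)) = integral (K 0 l) (\<lambda>s. \<alpha> l - w (t * s))"
            using wi h by (subst integral_diff) (auto simp: K_def)
          also have "norm \<dots> \<le> integral (K 0 l) (\<lambda>s. 2 * pi / r)"
            using near[of _ 0 l] wi by (intro integral_norm_bound_integral integrable_diff)
               (auto simp: K_def abs_minus_commute)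
          also have "\<dots> = 2 * pi / r * (h / r)" using h by (simp add: K_def)
          finally show "\<bar>\<alpha> l * (h / r) - integral (K 0 l) (\<lambda>s. w (t * s))\<bar> \<le> 2 * pi / r * (h / r)" by simp
        qed
        also have "\<dots> = 2 * pi / r * h" using r by simp
        finally have "\<bar>(\<Sum>l<r. \<alpha> l) / r\<bar> * h \<le> 2 * pi / r * h" using h by (simp add: abs_mult)
        then show ?thesis using h by (simp only: mult_le_cancel_right)
      qed
      have "norm V \<le> G"
      proof -
        have "V = integral {a..a + real N * h} F0" unfolding V_def by (rule gridI[OF F0, symmetric])
        also have "norm \<dots> \<le> integral {a..a + real N * h} (\<lambda>s. norm (F0 s))"
          using N2 by (intro integral_norm_bound_integral integrable_on_subinterval[OF F0] integrable_on_subinterval[OF nF0]) auto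
        also have "\<dots> \<le> G"
          unfolding G_def using N2 nF0 by (intro integral_subset_le integrable_on_subinterval[OF nF0]) auto
        finally show ?thesis .
      qed
      then have p3: "norm (((\<Sum>l<r. \<alpha> l) / r) *\<^sub>R V) \<le> 2 * pi / r * G"
        unfolding norm_scaleR using \<alpha> by (intro mult_mono) auto
      have "norm (integral {a..a + real N * h} H) \<le> 2 * pi / r * G + (\<epsilon> / 2 + 2 * pi / r * G)"
        using p1 p2 p3 norm_triangle_sub[of "integral {a..a + real N * h} H" "\<Sum>J<N. \<Sum>l<r. \<alpha> l *\<^sub>R integral (K J l) F0"]
          norm_triangle_ineq[of "\<Sum>l<r. \<alpha> l *\<^sub>R D l" "((\<Sum>l<r. \<alpha> l) / r) *\<^sub>R V"]
        unfolding split by linarith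
      moreover have "2 * pi / r * G + 2 * pi / r * G < \<epsilon> / 2" using r' by (simp add: mult_ac)
      ultimately have "norm (integral {a..a + real N * h} H) < \<epsilon>" by linarith
      then show ?thesis unfolding eq by simp
    qed
    note small = this
    show "\<forall>\<^sub>F t in at_top. norm (integral {a..b} (\<lambda>s. w (t * s) *\<^sub>R F s) - 0) < \<epsilon>"
      using eventually_gt_at_top[of "2 * pi / \<eta>"] eventually_gt_at_top[of "2 * pi"]
      by eventually_elim (rule small)
  qed
qed simp

lemma abs_cos_diff_le: "\<bar>cos x - cos y\<bar> \<le> \<bar>x - y\<bar>" for x y :: real
proof -
  have "\<bar>cos x - cos y\<bar> = 2 * \<bar>sin ((x + y) / 2)\<bar> * \<bar>sin ((y - x) / 2)\<bar>"
    by (simp add: cos_diff_cos abs_mult)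
  also have "\<dots> \<le> 2 * 1 * \<bar>(y - x) / 2\<bar>"
    by (intro mult_mono abs_sin_x_le_abs_x) auto
  finally show ?thesis by simp
qed

lemma abs_sin_diff_le: "\<bar>sin x - sin y\<bar> \<le> \<bar>x - y\<bar>" for x y :: real
  using abs_cos_diff_le[of "pi / 2 - x" "pi / 2 - y"] by (simp add: cos_diff)

lemma Riemann_Lebesgue_cos_sin:
  fixes F :: "real \<Rightarrow> 'a::banach"
  assumes "F integrable_on {a..b}" "(\<lambda>s. norm (F s)) integrable_on {a..b}"
  shows "((\<lambda>t. integral {a..b} (\<lambda>s. cos (t * s) *\<^sub>R F s)) \<longlongrightarrow> 0) at_top"
    and "((\<lambda>t. integral {a..b} (\<lambda>s. sin (t * s) *\<^sub>R F s)) \<longlongrightarrow> 0) at_top"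
proof -
  have c: "(cos has_integral 0) {x..x + 2 * pi}" for x :: real
  proof -
    have "(cos has_integral (sin (x + 2 * pi) - sin x)) {x..x + 2 * pi}"
      by (rule fundamental_theorem_of_calculus)
         (auto intro!: derivative_eq_intros simp: has_real_derivative_iff_has_vector_derivative[symmetric])
    then show ?thesis by simp
  qed
  have s: "(sin has_integral 0) {x..x + 2 * pi}" for x :: real
  proof -
    have "(sin has_integral (- cos (x + 2 * pi) - (- cos x))) {x..x + 2 * pi}"
      by (rule fundamental_theorem_of_calculus)
         (auto intro!: derivative_eq_intros simp: has_real_derivative_iff_has_vector_derivative[symmetric])
    then show ?thesis by simp
  qed
  show "((\<lambda>t. integral {a..b} (\<lambda>s. cos (t * s) *\<^sub>R F s)) \<longlongrightarrow> 0) at_top"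
    by (rule Riemann_Lebesgue_periodic[OF assms _ abs_cos_diff_le _ c]) auto
  show "((\<lambda>t. integral {a..b} (\<lambda>s. sin (t * s) *\<^sub>R F s)) \<longlongrightarrow> 0) at_top"
    by (rule Riemann_Lebesgue_periodic[OF assms _ abs_sin_diff_le _ s]) auto
qed

section \<open>The Fourier transform of the quartic cutoff\<close>

text \<open>The polynomial is even, so the cosine gives its full Fourier transform. For $u > 0$ it
  is a constant multiple of the Bessel expression $J_{5/2}(u) / u^{5/2}$.\<close>

definition kern :: "real \<Rightarrow> real" where
  "kern u = integral {-1..1} (\<lambda>s. (1 - s\<^sup>2)\<^sup>2 * cos (s * u))"

lemma kern_integrable: "(\<lambda>s. (1 - s\<^sup>2)\<^sup>2 * cos (s * u)) integrable_on {a..b}" for u :: real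
  by (intro integrable_continuous_interval continuous_intros)

lemma continuous_on_kern: "continuous_on S kern"
proof -
  have "continuous_on UNIV (\<lambda>u. integral (cbox (-1) 1) (\<lambda>s::real. (1 - s\<^sup>2)\<^sup>2 * cos (s * u)))"
    by (intro integral_continuous_on_param) (auto simp: split_def intro!: continuous_intros)
  then show ?thesis unfolding kern_def by (auto intro: continuous_on_subset)
qed

lemma kern_minus: "kern (- u) = kern u"
  by (simp add: kern_def)

lemma abs_kern_le_2: "\<bar>kern u\<bar> \<le> 2"
proof -
  have "norm (kern u) \<le> integral {-1..1} (\<lambda>s::real. 1::real)"
    unfolding kern_def
  proof (rule integral_norm_bound_integral[OF kern_integrable])
    fix s :: real assume "s \<in> {-1..1}"
    then have "s\<^sup>2 \<le> 1" by (simp add: abs_square_le_1 abs_le_iff)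
    then have "(1 - s\<^sup>2)\<^sup>2 \<le> 1" by (simp add: abs_square_le_1)
    then have "\<bar>(1 - s\<^sup>2)\<^sup>2\<bar> * \<bar>cos (s * u)\<bar> \<le> 1 * 1" by (intro mult_mono) auto
    then show "norm ((1 - s\<^sup>2)\<^sup>2 * cos (s * u)) \<le> 1" by (simp add: abs_mult)
  qed auto
  then show ?thesis by simp
qed

text \<open>The polynomial and its first derivative vanish at the endpoints, so no terms of order
  $1/u$ and $1/u^2$ appear. This is the source of the cubic decay.\<close>

lemma kern_closed_form:
  assumes "u \<noteq> 0"
  shows "kern u = - 16 * sin u / u^3 - 48 * cos u / u^4 + 48 * sin u / u^5"
proof -
  define v where "v = 1 / u"
  have vu: "v * u = 1" using assms by (simp add: v_def)
  \<comment> \<open>The antiderivative from repeated integration by parts, with the successive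
    derivatives of the quartic as coefficients. Writing \<open>v\<close> for \<open>1 / u\<close>
    keeps everything polynomial, so \<open>v * u = 1\<close> settles the derivative
    algebraically.\<close>
  define P where "P s = (1 - s\<^sup>2)\<^sup>2 * (sin (s * u) * v) + (4 * s^3 - 4 * s) * (cos (s * u) * v^2)
      - (12 * s^2 - 4) * (sin (s * u) * v^3) - 24 * s * (cos (s * u) * v^4) + 24 * (sin (s * u) * v^5)" for s
  have "((\<lambda>s. (1 - s\<^sup>2)\<^sup>2 * cos (s * u)) has_integral (P 1 - P (-1))) {-1..1}"
  proof (rule fundamental_theorem_of_calculus)
    fix s :: real
    have "(P has_real_derivative (1 - s\<^sup>2)\<^sup>2 * cos (s * u)) (at s)"
      unfolding P_def by (rule derivative_eq_intros refl)+ (simp, use vu in algebra)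
    then show "(P has_vector_derivative (1 - s\<^sup>2)\<^sup>2 * cos (s * u)) (at s within {-1..1})"
      by (simp add: has_real_derivative_iff_has_vector_derivative has_vector_derivative_at_within)
  qed simp
  then have "kern u = P 1 - P (-1)" unfolding kern_def by (rule integral_unique)
  then show ?thesis by (simp add: P_def v_def power_divide)
qed

text \<open>For $|u| \<ge> 1$ the higher inverse powers are absorbed into the cube, and 112 = 16 +
  48 + 48.\<close>

lemma abs_kern_le_cube:
  assumes "1 \<le> \<bar>u\<bar>"
  shows "\<bar>kern u\<bar> \<le> 112 / \<bar>u\<bar>^3"
proof -
  have u: "u \<noteq> 0" using assms by auto
  have "\<bar>kern u\<bar> \<le> \<bar>16 * sin u / u^3\<bar> + \<bar>48 * cos u / u^4\<bar> + \<bar>48 * sin u / u^5\<bar>"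
    unfolding kern_closed_form[OF u] by linarith
  also have "\<bar>16 * sin u / u^3\<bar> \<le> 16 / \<bar>u\<bar>^3"
    by (auto simp: abs_mult power_abs divide_simps)
  also have "\<bar>48 * cos u / u^4\<bar> \<le> 48 / \<bar>u\<bar>^3"
  proof -
    have "\<bar>48 * cos u / u^4\<bar> \<le> 48 / \<bar>u\<bar>^4" by (auto simp: abs_mult power_abs divide_simps)
    also have "\<dots> \<le> 48 / \<bar>u\<bar>^3" using assms by (intro divide_left_mono power_increasing) auto
    finally show ?thesis .
  qed
  also have "\<bar>48 * sin u / u^5\<bar> \<le> 48 / \<bar>u\<bar>^3"
  proof -
    have "\<bar>48 * sin u / u^5\<bar> \<le> 48 / \<bar>u\<bar>^5" by (auto simp: abs_mult power_abs divide_simps)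
    also have "\<dots> \<le> 48 / \<bar>u\<bar>^3" using assms by (intro divide_left_mono power_increasing) auto
    finally show ?thesis .
  qed
  finally show ?thesis by (simp add: add_divide_distrib[symmetric])
qed

text \<open>This form has an arctangent as antiderivative, so the first moment can be integrated
  explicitly. The factor 2 in 224 comes from $1 + u^2 \<le> 2 u^2$ for $|u| \<ge> 1$.\<close>

lemma abs_kern_moment_le: "\<bar>u\<bar> * \<bar>kern u\<bar> \<le> 224 / (1 + u\<^sup>2)"
proof (cases "1 \<le> \<bar>u\<bar>")
  case True
  have "\<bar>u\<bar> * \<bar>kern u\<bar> \<le> \<bar>u\<bar> * (112 / \<bar>u\<bar>^3)" by (intro mult_left_mono abs_kern_le_cube True) auto
  also have "\<dots> = 112 / u\<^sup>2" using True by (simp add: power3_eq_cube power2_eq_square field_simps)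
  also have "\<dots> \<le> 224 / (1 + u\<^sup>2)"
    using power_mono[OF True, of 2] by (simp add: divide_simps add_pos_nonneg)
  finally show ?thesis .
next
  case False
  have "\<bar>u\<bar> * \<bar>kern u\<bar> \<le> 1 * 2" using False by (intro mult_mono abs_kern_le_2) auto
  moreover have "u\<^sup>2 \<le> 1" using False by (simp add: abs_square_le_1)
  ultimately have "\<bar>u\<bar> * \<bar>kern u\<bar> * (1 + u\<^sup>2) \<le> 2 * 2" by (intro mult_mono) auto
  then show ?thesis by (simp add: pos_le_divide_eq add_pos_nonneg)
qed

text \<open>This gives the total mass of the kernel without Fourier inversion. In $(1 - s^2)^2 = 1 +
  (s^4 - 2 s^2)$ the constant yields twice the sine integral. In the rest, integrating $cos(su)$ in
  $u$ produces $1/s$, which the factor $s^2$ absorbs; the remaining sine integral tends to 0 by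
  Riemann--Lebesgue.\<close>

lemma integral_kern_Si:
  assumes "x \<ge> 0"
  shows "integral {0..x} kern = 2 * Si x + integral {-1..1} (\<lambda>s. (s^3 - 2 * s) * sin (s * x))"
proof -
  have sinc: "integral {-1..1} (\<lambda>s. cos (s * u)) = 2 * sinc u" for u :: real
  proof (cases "u = 0")
    case False
    have "((\<lambda>s. cos (s * u)) has_integral (sin (1 * u) / u - sin (-1 * u) / u)) {-1..1}"
    proof (rule fundamental_theorem_of_calculus)
      fix s :: real
      show "((\<lambda>s. sin (s * u) / u) has_vector_derivative cos (s * u)) (at s within {-1..1})"
        unfolding has_real_derivative_iff_has_vector_derivative[symmetric]
        using False by (auto intro!: derivative_eq_intros)
    qed simp
    then show ?thesis using False by (simp add: integral_unique)
  qed simp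
  have Si: "((\<lambda>u. 2 * sinc u) has_integral (2 * Si x - 2 * Si 0)) {0..x}"
    by (rule fundamental_theorem_of_calculus[OF assms])
       (metis DERIV_cmult[OF DERIV_Si] has_real_derivative_iff_has_vector_derivative has_vector_derivative_at_within)
  have "Si 0 = 0" unfolding Si_def by (simp flip: zero_ereal_def)
  then have "integral {0..x} (\<lambda>u. 2 * sinc u) = 2 * Si x"
    using integral_unique[OF Si] by simp
  then have "integral {0..x} kern - 2 * Si x = integral {0..x} (\<lambda>u. kern u - 2 * sinc u)"
    using Si by (subst integral_diff) (auto intro: integrable_continuous_interval continuous_on_kern has_integral_integrable)
  also have "\<dots> = integral {0..x} (\<lambda>u. integral {-1..1} (\<lambda>s. (s^4 - 2 * s^2) * cos (s * u)))"
  proof (rule integral_cong)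
    fix u
    have "kern u - 2 * sinc u = integral {-1..1} (\<lambda>s. (1 - s\<^sup>2)\<^sup>2 * cos (s * u) - cos (s * u))"
      unfolding sinc[symmetric] kern_def
      by (subst integral_diff) (auto intro!: integrable_continuous_interval continuous_intros)
    also have "(\<lambda>s. (1 - s\<^sup>2)\<^sup>2 * cos (s * u) - cos (s * u)) = (\<lambda>s. (s^4 - 2 * s^2) * cos (s * u))"
      by (rule ext) algebra
    finally show "kern u - 2 * sinc u = integral {-1..1} (\<lambda>s. (s^4 - 2 * s^2) * cos (s * u))" .
  qed
  also have "\<dots> = integral {-1..1} (\<lambda>s. integral {0..x} (\<lambda>u. (s^4 - 2 * s^2) * cos (s * u)))"
    unfolding box_real[symmetric]
    by (rule integral_swap_continuous) (auto simp: split_def intro!: continuous_intros)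
  also have "\<dots> = integral {-1..1} (\<lambda>s. (s^3 - 2 * s) * sin (s * x))"
  proof (rule integral_cong)
    fix s :: real
    have "((\<lambda>u. (s^4 - 2 * s^2) * cos (s * u)) has_integral ((s^3 - 2 * s) * sin (s * x) - (s^3 - 2 * s) * sin (s * 0))) {0..x}"
    proof (rule fundamental_theorem_of_calculus[OF assms])
      fix u :: real
      have "((\<lambda>u. (s^3 - 2 * s) * sin (s * u)) has_real_derivative (s^4 - 2 * s^2) * cos (s * u)) (at u)"
        by (rule derivative_eq_intros refl)+ (simp, algebra)
      then show "((\<lambda>u. (s^3 - 2 * s) * sin (s * u)) has_vector_derivative (s^4 - 2 * s^2) * cos (s * u)) (at u within {0..x})"
        by (simp add: has_real_derivative_iff_has_vector_derivative has_vector_derivative_at_within)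
    qed
    from integral_unique[OF this] show "integral {0..x} (\<lambda>u. (s^4 - 2 * s^2) * cos (s * u)) = (s^3 - 2 * s) * sin (s * x)"
      by (simp only: mult_zero_right sin_zero diff_zero)
  qed
  finally show ?thesis by simp
qed

lemma integral_kern_tendsto: "((\<lambda>x. integral {0..x} kern) \<longlongrightarrow> pi) at_top"
proof -
  have "((\<lambda>x. integral {-1..1} (\<lambda>s. sin (x * s) *\<^sub>R (s^3 - 2 * s))) \<longlongrightarrow> 0) at_top"
    by (intro Riemann_Lebesgue_cos_sin integrable_continuous_interval continuous_intros)
  then have "((\<lambda>x. 2 * Si x + integral {-1..1} (\<lambda>s. (s^3 - 2 * s) * sin (s * x))) \<longlongrightarrow> 2 * (pi / 2) + 0) at_top"
    by (intro tendsto_intros Si_at_top) (simp add: mult.commute)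
  then have "((\<lambda>x. 2 * Si x + integral {-1..1} (\<lambda>s. (s^3 - 2 * s) * sin (s * x))) \<longlongrightarrow> pi) at_top" by simp
  then show ?thesis
    by (rule Lim_transform_eventually) (rule eventually_mono[OF eventually_ge_at_top[of 0]], simp add: integral_kern_Si)
qed

text \<open>It measures the kernel mass that is lost because \<open>f\<close> lives on a half-line.
  The cubic decay would even give order $x^{-2}$; the order $1/x$ suffices.\<close>

lemma integral_kern_tail:
  assumes "x \<ge> 1"
  shows "\<bar>pi - integral {0..x} kern\<bar> \<le> 112 / x"
proof -
  have "\<bar>integral {0..y} kern - integral {0..x} kern\<bar> \<le> 112 / x" if y: "y \<ge> x" for y
  proof -
    have b: "((\<lambda>u. 112 / u\<^sup>2) has_integral (- 112 / y - (- 112 / x))) {x..y}"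
    proof (rule fundamental_theorem_of_calculus[OF y])
      fix u assume "u \<in> {x..y}"
      then have "u \<noteq> 0" using assms by auto
      then have "((\<lambda>u. - 112 / u) has_real_derivative 112 / u\<^sup>2) (at u)"
        by (auto intro!: derivative_eq_intros simp: power2_eq_square)
      then show "((\<lambda>u. - 112 / u) has_vector_derivative 112 / u\<^sup>2) (at u within {x..y})"
        by (simp add: has_real_derivative_iff_has_vector_derivative has_vector_derivative_at_within)
    qed
    have "integral {0..x} kern + integral {x..y} kern = integral {0..y} kern"
      using assms y by (intro Henstock_Kurzweil_Integration.integral_combine integrable_continuous_interval continuous_on_kern) auto
    then have "\<bar>integral {0..y} kern - integral {0..x} kern\<bar> = norm (integral {x..y} kern)" by simp
    also have "norm (integral {x..y} kern) \<le> integral {x..y} (\<lambda>u. 112 / u\<^sup>2)"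
    proof (rule integral_norm_bound_integral)
      show "(\<lambda>u. 112 / u\<^sup>2) integrable_on {x..y}" using b by (rule has_integral_integrable)
      fix u assume "u \<in> {x..y}"
      then have u: "u \<ge> 1" using assms by auto
      then have "\<bar>kern u\<bar> \<le> 112 / \<bar>u\<bar>^3" by (intro abs_kern_le_cube) auto
      also have "\<dots> \<le> 112 / \<bar>u\<bar>^2" using u by (intro divide_left_mono power_increasing) auto
      finally show "norm (kern u) \<le> 112 / u\<^sup>2" by simp
    qed (intro integrable_continuous_interval continuous_on_kern)
    also have "\<dots> = 112 / x - 112 / y" using b by (simp add: integral_unique)
    also have "\<dots> \<le> 112 / x" using assms y by simp
    finally show ?thesis .
  qed
  then have ev: "\<forall>\<^sub>F y in at_top. \<bar>integral {0..y} kern - integral {0..x} kern\<bar> \<le> 112 / x"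
    by (rule eventually_mono[OF eventually_ge_at_top])
  have "((\<lambda>y. \<bar>integral {0..y} kern - integral {0..x} kern\<bar>) \<longlongrightarrow> \<bar>pi - integral {0..x} kern\<bar>) at_top"
    by (rule tendsto_rabs[OF tendsto_diff[OF integral_kern_tendsto tendsto_const]])
  from tendsto_upperbound[OF this ev] show ?thesis by simp
qed

section \<open>Approximation of a function by its boundary function\<close>

lemma bounded_bilinear_scaleC:
  "bounded_bilinear (scaleC :: complex \<Rightarrow> 'a::complex_banach \<Rightarrow> 'a)"
proof
  show "\<exists>K. \<forall>a b. norm (scaleC a b :: 'a) \<le> norm a * norm b * K"
    by (intro exI[of _ 1]) (simp add: norm_scaleC)
  show "scaleC (r *\<^sub>R a) b = r *\<^sub>R (scaleC a b :: 'a)" for r a b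
    by (metis scaleC_of_real scaleC_scaleC scaleR_conv_of_real)
  show "scaleC a (r *\<^sub>R b) = r *\<^sub>R (scaleC a b :: 'a)" for r a b
    by (metis mult.commute scaleC_of_real scaleC_scaleC)
qed (simp_all add: scaleC_add_left scaleC_add_right)

lemmas continuous_on_scaleC [continuous_intros] = bounded_bilinear.continuous_on[OF bounded_bilinear_scaleC]

lemmas bounded_linear_scaleC_left = bounded_bilinear.bounded_linear_left[OF bounded_bilinear_scaleC]
lemmas bounded_linear_scaleC_right = bounded_bilinear.bounded_linear_right[OF bounded_bilinear_scaleC]

lemma scaleC_cis: "scaleC (cis x) y = cos x *\<^sub>R y + scaleC \<i> (sin x *\<^sub>R y)"
proof -
  have "cis x = of_real (cos x) + \<i> * of_real (sin x)" by (simp add: complex_eq_iff)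
  then show ?thesis by (metis scaleC_add_left scaleC_of_real scaleC_scaleC)
qed

lemma exp_decay_tendsto:
  fixes \<alpha> C :: real
  assumes "\<alpha> > 0"
  shows "((\<lambda>x. C * exp (- \<alpha> * x)) \<longlongrightarrow> 0) at_top"
proof -
  have "((\<lambda>x. exp (- (\<alpha> * x))) \<longlongrightarrow> 0) at_top"
    using assms by (intro filterlim_compose[OF exp_at_bot] filterlim_compose[OF filterlim_uminus_at_bot_at_top]
        filterlim_tendsto_pos_mult_at_top[OF tendsto_const]) (auto intro: filterlim_ident)
  from tendsto_mult_right_zero[OF this, of C] show ?thesis by simp
qed

text \<open>The integral over the half-line has its intended value only once existence is proved; it
  is obtained as the limit of the truncated integrals, which are Cauchy. The error depends on
  \<open>h\<close> only through \<open>B\<close> and \<open>\<alpha>\<close>, which later gives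
  uniformity in the frequency.\<close>

lemma integral_exp_decay:
  fixes h :: "real \<Rightarrow> 'a::banach"
  assumes cont: "continuous_on {0..} h" and le: "\<And>x. x \<ge> 0 \<Longrightarrow> norm (h x) \<le> B * exp (- \<alpha> * x)"
    and \<alpha>: "\<alpha> > 0" and T: "T \<ge> 0"
  shows "norm (integral {0..} h - integral {0..T} h) \<le> B / \<alpha> * exp (- \<alpha> * T)"
proof -
  define I where "I T = integral {0..T} h" for T
  have hi: "h integrable_on {a..b}" if "a \<ge> 0" for a b
    using cont that by (intro integrable_continuous_interval continuous_on_subset[OF cont]) auto
  have B0: "B \<ge> 0" using order_trans[OF norm_ge_zero le[of 0]] by simp
  have tail: "norm (I y - I x) \<le> B / \<alpha> * exp (- \<alpha> * x)" if xy: "0 \<le> x" "x \<le> y" for x y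
  proof -
    have e: "((\<lambda>u. B * exp (- \<alpha> * u)) has_integral (- B / \<alpha> * exp (- \<alpha> * y) - (- B / \<alpha> * exp (- \<alpha> * x)))) {x..y}"
    proof (rule fundamental_theorem_of_calculus[OF xy(2)])
      fix u :: real
      have "((\<lambda>u. - B / \<alpha> * exp (- \<alpha> * u)) has_real_derivative B * exp (- \<alpha> * u)) (at u)"
        using \<alpha> by (auto intro!: derivative_eq_intros)
      then show "((\<lambda>u. - B / \<alpha> * exp (- \<alpha> * u)) has_vector_derivative B * exp (- \<alpha> * u)) (at u within {x..y})"
        by (simp add: has_real_derivative_iff_has_vector_derivative has_vector_derivative_at_within)
    qed
    have "I x + integral {x..y} h = I y"
      unfolding I_def using xy by (intro Henstock_Kurzweil_Integration.integral_combine hi) auto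
    then have "norm (I y - I x) = norm (integral {x..y} h)" by (metis add_diff_cancel_left')
    also have "\<dots> \<le> integral {x..y} (\<lambda>u. B * exp (- \<alpha> * u))"
      using xy le e by (intro integral_norm_bound_integral hi) (auto dest: has_integral_integrable)
    also have "\<dots> = - B / \<alpha> * exp (- \<alpha> * y) - (- B / \<alpha> * exp (- \<alpha> * x))" using e by (rule integral_unique)
    also have "\<dots> \<le> B / \<alpha> * exp (- \<alpha> * x)" using B0 \<alpha> by simp
    finally show ?thesis .
  qed
  note small = exp_decay_tendsto[OF \<alpha>, of "B / \<alpha>"]
  have "Cauchy (\<lambda>n. I (real n))"
  proof (rule CauchyI')
    fix e :: real assume "e > 0"
    with small have "\<forall>\<^sub>F x in at_top. B / \<alpha> * exp (- \<alpha> * x) < e" by (rule order_tendstoD)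
    then obtain x0 where x0: "\<And>x. x \<ge> x0 \<Longrightarrow> B / \<alpha> * exp (- \<alpha> * x) < e" by (auto simp: eventually_at_top_linorder)
    obtain N where N: "real N \<ge> x0" using real_arch_simple by blast
    have "norm (I (real m) - I (real n)) < e" if "m \<ge> N" "n > m" for m n
      using tail[of "real m" "real n"] that N x0[of "real m"] by (simp add: norm_minus_commute)
    then show "\<exists>M. \<forall>m\<ge>M. \<forall>n>m. dist (I (real m)) (I (real n)) < e" unfolding dist_norm by blast
  qed
  then obtain l where l: "(\<lambda>n. I (real n)) \<longlonglongrightarrow> l" using Cauchy_convergent convergent_def by blast
  have lI: "norm (l - I x) \<le> B / \<alpha> * exp (- \<alpha> * x)" if x: "x \<ge> 0" for x
  proof (rule tendsto_upperbound)
    show "(\<lambda>n. norm (I (real n) - I x)) \<longlonglongrightarrow> norm (l - I x)" by (intro tendsto_intros l)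
    obtain N where N: "real N \<ge> x" using real_arch_simple by blast
    show "\<forall>\<^sub>F n in sequentially. norm (I (real n) - I x) \<le> B / \<alpha> * exp (- \<alpha> * x)"
      unfolding eventually_sequentially
    proof (intro exI[of _ N] allI impI)
      fix n assume "N \<le> n"
      then have "x \<le> real n" using N by linarith
      then show "norm (I (real n) - I x) \<le> B / \<alpha> * exp (- \<alpha> * x)" using tail x by blast
    qed
  qed simp
  have "(h has_integral l) {0..}"
    unfolding has_integral_alt'
  proof (intro conjI allI impI)
    fix a b :: real
    have "{0..} \<inter> cbox a b = {max 0 a..b}" by auto
    then show "(\<lambda>x. if x \<in> {0..} then h x else 0) integrable_on cbox a b"
      unfolding integrable_restrict_Int by (simp add: hi)
  next
    fix e :: real assume "e > 0"
    with small have "\<forall>\<^sub>F x in at_top. B / \<alpha> * exp (- \<alpha> * x) < e" by (rule order_tendstoD)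
    then obtain x0 where x0: "\<And>x. x \<ge> x0 \<Longrightarrow> B / \<alpha> * exp (- \<alpha> * x) < e" by (auto simp: eventually_at_top_linorder)
    define C where "C = max 1 x0"
    have "norm (integral (cbox a b) (\<lambda>x. if x \<in> {0..} then h x else 0) - l) < e" if "ball 0 C \<subseteq> cbox a b" for a b
    proof -
      have "{-C<..<C} \<subseteq> {a..b}" using that by (simp add: ball_eq_greaterThanLessThan)
      moreover have "- C < C" by (simp add: C_def)
      ultimately have ab: "a \<le> - C" "C \<le> b" by (auto simp: greaterThanLessThan_subseteq_atLeastAtMost_iff)
      then have "{0..} \<inter> cbox a b = {0..b}" by (auto simp: C_def)
      then have "integral (cbox a b) (\<lambda>x. if x \<in> {0..} then h x else 0) = I b"
        unfolding integral_restrict_Int I_def by (simp only:)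
      moreover have "b \<ge> 0" "b \<ge> x0" using ab by (auto simp: C_def)
      ultimately show ?thesis using lI[of b] x0[of b] by (simp add: norm_minus_commute)
    qed
    then show "\<exists>B>0. \<forall>a b. ball 0 B \<subseteq> cbox a b \<longrightarrow> norm (integral (cbox a b) (\<lambda>x. if x \<in> {0..} then h x else 0) - l) < e"
      by (intro exI[of _ C]) (auto simp: C_def)
  qed
  then have "integral {0..} h = l" by (rule integral_unique)
  then show ?thesis using lI[OF T] by (simp add: I_def)
qed

text \<open>The inner \<open>max\<close> makes the function continuous on the whole line, as
  membership in \<open>Cc\<close> demands; on \<open>{-R..R}\<close> it is the polynomial.\<close>

definition cutoff :: "real \<Rightarrow> real \<Rightarrow> real" where
  "cutoff R s = (max 0 (1 - (s / R)\<^sup>2))\<^sup>2"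

lemma cutoff_inside: "R > 0 \<Longrightarrow> s \<in> {-R..R} \<Longrightarrow> cutoff R s = (1 - (s / R)\<^sup>2)\<^sup>2"
  by (auto simp: cutoff_def max_def abs_le_iff power2_le_iff_abs_le power_divide abs_square_le_1)

lemma cutoff_outside: "R > 0 \<Longrightarrow> s \<notin> {-R..R} \<Longrightarrow> cutoff R s = 0"
proof -
  assume R: "R > 0" "s \<notin> {-R..R}"
  then have "\<bar>s / R\<bar> \<ge> 1" by (auto simp: abs_if field_simps)
  then have "(s / R)\<^sup>2 \<ge> 1" by (metis one_le_power power2_abs)
  then show ?thesis by (simp add: cutoff_def)
qed

lemma continuous_on_cutoff [continuous_intros]: "R > 0 \<Longrightarrow> continuous_on S (cutoff R)"
  unfolding cutoff_def by (intro continuous_intros) auto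

lemma cutoff_cis_in_Cc:
  assumes "R > 0"
  shows "(\<lambda>s. of_real (cutoff R s) * cis (s * t)) \<in> Cc"
proof -
  have "continuous_on UNIV (\<lambda>s. of_real (cutoff R s) * cis (s * t))"
    using assms by (intro continuous_intros)
  moreover have "{s. of_real (cutoff R s) * cis (s * t) \<noteq> 0} \<subseteq> {-R..R}"
    using cutoff_outside[OF assms] by fastforce
  ultimately show ?thesis unfolding Cc_def using bounded_subset[OF bounded_closed_interval] by blast
qed

lemma integral_UNIV_cutoff:
  fixes g :: "real \<Rightarrow> 'a::complex_banach"
  assumes "R > 0"
  shows "integral UNIV (\<lambda>s. scaleC (of_real (cutoff R s) * cis (s * t)) (g s))
    = integral {-R..R} (\<lambda>s. scaleC (of_real (cutoff R s) * cis (s * t)) (g s))"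
proof -
  have z: "scaleC 0 x = (0::'a)" for x using scaleC_of_real[of 0 x] by simp
  have "(\<lambda>s. scaleC (of_real (cutoff R s) * cis (s * t)) (g s))
    = (\<lambda>s. if s \<in> {-R..R} then scaleC (of_real (cutoff R s) * cis (s * t)) (g s) else 0)"
    using cutoff_outside[OF assms] by (auto simp: z)
  then show ?thesis by (rule ssubst[OF _, where P = "\<lambda>h. integral UNIV h = _"]) (rule integral_restrict_UNIV)
qed

lemma integral_cutoff_cis:
  assumes R: "R > 0"
  shows "((\<lambda>s. of_real (cutoff R s) * cis (s * u)) has_integral of_real (R * kern (R * u))) {-R..R}"
proof -
  have 1: "((\<lambda>s. cutoff R s * cos (s * u)) has_integral R * kern (R * u)) {-R..R}"
  proof -
    have "((\<lambda>s. (1 - s\<^sup>2)\<^sup>2 * cos (s * (R * u))) has_integral kern (R * u)) (cbox (-1) 1)"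
      unfolding kern_def box_real by (intro integrable_integral kern_integrable)
    from has_integral_affinity[OF this, of "1 / R" 0]
    have "((\<lambda>s. (1 - (s / R)\<^sup>2)\<^sup>2 * cos (s / R * (R * u))) has_integral R * kern (R * u)) ((\<lambda>x. R * x) ` {-1..1})"
      using R by simp
    also have "(\<lambda>x. R * x) ` {-1..1} = {-R..R}" using R by (simp add: image_mult_atLeastAtMost)
    finally show ?thesis
      by (rule has_integral_eq[rotated]) (use R cutoff_inside in auto)
  qed
  have 2: "((\<lambda>s. cutoff R s * sin (s * u)) has_integral 0) {-R..R}"
  proof -
    let ?g = "\<lambda>s. cutoff R s * sin (s * u)"
    have gi: "(?g has_integral integral {-R..R} ?g) {-R..R}"
      using R by (intro integrable_integral integrable_continuous_interval continuous_intros)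
    then have "((\<lambda>s. ?g (- s)) has_integral integral {-R..R} ?g) {-R..- (- R)}"
      by (subst has_integral_reflect_real)
    moreover have "(\<lambda>s. ?g (- s)) = (\<lambda>s. - ?g s)" by (auto simp: cutoff_def)
    ultimately have "((\<lambda>s. - ?g s) has_integral integral {-R..R} ?g) {-R..R}" by simp
    with has_integral_neg[OF gi] have "- integral {-R..R} ?g = integral {-R..R} ?g" by (rule has_integral_unique)
    with gi show ?thesis by simp
  qed
  have "((\<lambda>s. of_real (cutoff R s * cos (s * u)) + \<i> * of_real (cutoff R s * sin (s * u))) has_integral
      of_real (R * kern (R * u)) + \<i> * of_real 0) {-R..R}"
    using has_integral_linear[OF 1 bounded_linear_of_real] has_integral_linear[OF 2 bounded_linear_of_real]
    by (intro has_integral_add has_integral_mult_right) (simp_all add: o_def)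
  moreover have "of_real (cutoff R s * cos (s * u)) + \<i> * of_real (cutoff R s * sin (s * u)) = of_real (cutoff R s) * cis (s * u)" for s
    by (simp add: complex_eq_iff)
  ultimately show ?thesis by simp
qed

text \<open>The order of integration is exchanged only on a compact rectangle, where the integrand
  is continuous. The passage to the full Laplace transform is a uniform limit in \<open>s\<close>,
  so no improper double integral occurs.\<close>

lemma laplace_cutoff_tendsto:
  fixes f :: "real \<Rightarrow> 'a::complex_banach"
  assumes f: "continuous_on {0..} f" and B: "\<And>x. x \<ge> 0 \<Longrightarrow> norm (f x) \<le> B"
    and \<alpha>: "\<alpha> > 0" and R: "R > 0"
  shows "((\<lambda>T. integral {0..T} (\<lambda>x. (R * kern (R * (t - x))) *\<^sub>R (exp (- \<alpha> * x) *\<^sub>R f x))) \<longlongrightarrow>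
    integral UNIV (\<lambda>s. scaleC (of_real (cutoff R s) * cis (s * t)) (laplace f (of_real \<alpha> + \<i> * of_real s)))) at_top"
proof -
  define cut where "cut s = of_real (cutoff R s) * cis (s * t)" for s
  define e where "e s x = exp (- (of_real \<alpha> + \<i> * of_real s) * of_real x :: complex)" for s x
  define L where "L s = laplace f (of_real \<alpha> + \<i> * of_real s)" for s
  define LT where "LT T s = integral {0..T} (\<lambda>x. scaleC (e s x) (f x))" for T s
  have norm_e: "norm (e s x) = exp (- \<alpha> * x)" for s x
    by (simp add: e_def)
  have e_cis: "e s x = of_real (exp (- \<alpha> * x)) * cis (- s * x)" for s x
    by (simp add: e_def cis_conv_exp exp_of_real[symmetric] algebra_simps exp_add[symmetric])
  \<comment> \<open>The modulus of \<open>e s x\<close> does not depend on \<open>s\<close>, hence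
    neither does this bound.\<close>
  have close: "norm (L s - LT T s) \<le> B / \<alpha> * exp (- \<alpha> * T)" if "T \<ge> 0" for T s
    unfolding L_def LT_def laplace_def e_def[symmetric]
  proof (rule integral_exp_decay[OF _ _ \<alpha> that])
    show "continuous_on {0..} (\<lambda>x. scaleC (e s x) (f x))"
      unfolding e_def by (intro continuous_intros f)
    show "norm (scaleC (e s x) (f x)) \<le> B * exp (- \<alpha> * x)" if "x \<ge> 0" for x
      using mult_left_mono[OF B[OF that], of "exp (- \<alpha> * x)"] by (simp add: norm_scaleC norm_e mult.commute)
  qed
  have jcont: "continuous_on (cbox (-R, 0) (R, T)) (\<lambda>(s, x). scaleC (cut s) (scaleC (e s x) (f x)))" for T
  proof -
    have "continuous_on (cbox (-R, 0) (R, T)) (\<lambda>p. f (snd p))"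
      by (rule continuous_on_compose2[OF f]) (auto intro!: continuous_intros simp: cbox_Pair_eq)
    moreover have "continuous_on (cbox (-R, 0) (R, T)) (\<lambda>p. cutoff R (fst p))"
      by (rule continuous_on_compose2[OF continuous_on_cutoff[OF R, of UNIV]]) (auto intro!: continuous_intros)
    ultimately show ?thesis
      unfolding split_def cut_def e_def by (intro continuous_intros)
  qed
  have pull: "scaleC (cut s) (LT T s) = integral (cbox 0 T) (\<lambda>x. scaleC (cut s) (scaleC (e s x) (f x)))" for s T
  proof -
    have "(\<lambda>x. scaleC (e s x) (f x)) integrable_on {0..T}"
      unfolding e_def by (intro integrable_continuous_interval continuous_intros continuous_on_subset[OF f]) auto
    from integral_linear[OF this bounded_linear_scaleC_right[of "cut s"]] show ?thesis
      by (simp add: LT_def o_def)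
  qed
  have LTcont: "continuous_on {-R..R} (\<lambda>s. scaleC (cut s) (LT T s))" for T
  proof -
    have "continuous_on (cbox (-R) R) (\<lambda>s. integral (cbox 0 T) (\<lambda>x. scaleC (cut s) (scaleC (e s x) (f x))))"
    proof (rule integral_continuous_on_param)
      have "cbox (-R) R \<times> cbox 0 T = cbox (-R, 0) (R, T)" by (simp only: cbox_Pair_eq)
      then show "continuous_on (cbox (-R) R \<times> cbox 0 T) (\<lambda>(s, x). scaleC (cut s) (scaleC (e s x) (f x)))"
        using jcont by (simp only:)
    qed
    then show ?thesis by (simp add: pull)
  qed
  have unif: "uniform_limit {-R..R} (\<lambda>T s. scaleC (cut s) (LT T s)) (\<lambda>s. scaleC (cut s) (L s)) at_top"
    unfolding uniform_limit_iff
  proof (intro allI impI)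
    fix \<epsilon> :: real assume \<epsilon>: "\<epsilon> > 0"
    from exp_decay_tendsto[OF \<alpha>]
    have "\<forall>\<^sub>F T in at_top. B / \<alpha> * exp (- \<alpha> * T) < \<epsilon>" using \<epsilon> by (rule order_tendstoD)
    with eventually_ge_at_top[of "0::real"]
    show "\<forall>\<^sub>F T in at_top. \<forall>s\<in>{-R..R}. dist (scaleC (cut s) (LT T s)) (scaleC (cut s) (L s)) < \<epsilon>"
    proof eventually_elim
      case (elim T)
      show ?case
      proof
        fix s assume s: "s \<in> {-R..R}"
        have "\<bar>s / R\<bar> \<le> 1" using s R by (simp add: abs_le_iff divide_simps)
        then have "(s / R)\<^sup>2 \<le> 1" by (simp only: abs_square_le_1)
        then have "\<bar>1 - (s / R)\<^sup>2\<bar> \<le> 1" using zero_le_power2[of "s / R"] by linarith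
        then have "(1 - (s / R)\<^sup>2)\<^sup>2 \<le> 1" by (simp only: abs_square_le_1)
        then have "\<bar>cutoff R s\<bar> \<le> 1" using cutoff_inside[OF R s] by simp
        then have cut1: "norm (cut s) \<le> 1" by (simp add: cut_def norm_mult)
        have "dist (scaleC (cut s) (LT T s)) (scaleC (cut s) (L s)) = norm (cut s) * norm (L s - LT T s)"
          by (simp add: dist_norm norm_minus_commute norm_scaleC flip: bounded_bilinear.diff_right[OF bounded_bilinear_scaleC])
        also have "\<dots> \<le> 1 * (B / \<alpha> * exp (- \<alpha> * T))"
          using cut1 close[OF elim(1)] by (intro mult_mono) auto
        finally show "dist (scaleC (cut s) (LT T s)) (scaleC (cut s) (L s)) < \<epsilon>" using elim(2) by simp
      qed
    qed
  qed
  obtain I J where I: "\<And>T. ((\<lambda>s. scaleC (cut s) (LT T s)) has_integral I T) {-R..R}"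
    and J: "((\<lambda>s. scaleC (cut s) (L s)) has_integral J) {-R..R}" and lim: "(I \<longlongrightarrow> J) at_top"
    by (rule uniform_limit_integral[OF unif LTcont]) auto
  have "I T = integral {0..T} (\<lambda>x. (R * kern (R * (t - x))) *\<^sub>R (exp (- \<alpha> * x) *\<^sub>R f x))" for T
  proof -
    have "I T = integral (cbox (-R) R) (\<lambda>s. integral (cbox 0 T) (\<lambda>x. scaleC (cut s) (scaleC (e s x) (f x))))"
      using I[of T] by (simp add: integral_unique pull)
    also have "\<dots> = integral (cbox 0 T) (\<lambda>x. integral (cbox (-R) R) (\<lambda>s. scaleC (cut s) (scaleC (e s x) (f x))))"
      by (rule integral_swap_continuous[OF jcont])
    also have "\<dots> = integral (cbox 0 T) (\<lambda>x. (R * kern (R * (t - x))) *\<^sub>R (exp (- \<alpha> * x) *\<^sub>R f x))"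
    proof (rule integral_cong)
      fix x
      have "scaleC (cut s) (scaleC (e s x) (f x)) = scaleC (of_real (cutoff R s) * cis (s * (t - x))) (exp (- \<alpha> * x) *\<^sub>R f x)" for s
      proof -
        have "cut s * e s x = of_real (cutoff R s) * cis (s * (t - x)) * of_real (exp (- \<alpha> * x))"
          by (simp add: cut_def e_cis cis_mult algebra_simps)
        then show ?thesis by (metis scaleC_scaleC scaleC_of_real)
      qed
      moreover have "((\<lambda>s. scaleC (of_real (cutoff R s) * cis (s * (t - x))) (exp (- \<alpha> * x) *\<^sub>R f x))
          has_integral (R * kern (R * (t - x))) *\<^sub>R (exp (- \<alpha> * x) *\<^sub>R f x)) {-R..R}"
        using has_integral_linear[OF integral_cutoff_cis[OF R, of "t - x"] bounded_linear_scaleC_left[of "exp (- \<alpha> * x) *\<^sub>R f x"]]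
        by (simp only: o_def scaleC_of_real)
      ultimately show "integral (cbox (-R) R) (\<lambda>s. scaleC (cut s) (scaleC (e s x) (f x))) = (R * kern (R * (t - x))) *\<^sub>R (exp (- \<alpha> * x) *\<^sub>R f x)"
        by (simp only: integral_unique box_real)
    qed
    finally show ?thesis by simp
  qed
  then have "I = (\<lambda>T. integral {0..T} (\<lambda>x. (R * kern (R * (t - x))) *\<^sub>R (exp (- \<alpha> * x) *\<^sub>R f x)))" by blast
  moreover have "J = integral UNIV (\<lambda>s. scaleC (cut s) (L s))"
    using J integral_UNIV_cutoff[OF R, of t L] by (simp add: cut_def integral_unique)
  ultimately show ?thesis using lim by (simp only: cut_def L_def)
qed

text \<open>The substitution is made separately on the two sides of \<open>t\<close>; on the right
  side the evenness of \<open>kern\<close> makes the arguments nonnegative.\<close>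

lemma integral_shifted_kern:
  assumes R: "R > 0" and t: "0 \<le> t" "t \<le> T"
  shows "((\<lambda>x. R * kern (R * (t - x))) has_integral (integral {0..R * t} kern + integral {0..R * (T - t)} kern)) {0..T}"
proof -
  have K: "(kern has_integral integral {0..y} kern) (cbox 0 y)" for y
    by (simp add: integrable_integral integrable_continuous_interval continuous_on_kern)
  have "((\<lambda>x. R * kern (R * (t - x))) has_integral integral {0..R * t} kern) {0..t}"
  proof -
    from has_integral_affinity[OF K[of "R * t"], of "-R" "R * t"]
    have "((\<lambda>x. kern (R * (t - x))) has_integral (1 / R * integral {0..R * t} kern)) ((\<lambda>x. t - x / R) ` {0..R * t})"
      using R by (simp add: algebra_simps)
    also have "(\<lambda>x. t - x / R) ` {0..R * t} = {0..t}"
    proof (intro equalityI subsetI)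
      fix y assume "y \<in> {0..t}"
      then show "y \<in> (\<lambda>x. t - x / R) ` {0..R * t}" using R by (intro image_eqI[of _ _ "R * (t - y)"]) auto
    qed (use R in \<open>auto simp: field_simps\<close>)
    finally have "((\<lambda>x. kern (R * (t - x))) has_integral (1 / R * integral {0..R * t} kern)) {0..t}" .
    from has_integral_mult_right[OF this, of R] show ?thesis using R by simp
  qed
  moreover have "((\<lambda>x. R * kern (R * (t - x))) has_integral integral {0..R * (T - t)} kern) {t..T}"
  proof -
    from has_integral_affinity[OF K[of "R * (T - t)"], of R "- R * t"]
    have "((\<lambda>x. kern (R * x - R * t)) has_integral (1 / R * integral {0..R * (T - t)} kern)) ((\<lambda>x. t + x / R) ` {0..R * (T - t)})"
      using R by (simp add: algebra_simps)
    also have "(\<lambda>x. t + x / R) ` {0..R * (T - t)} = {t..T}"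
    proof (intro equalityI subsetI)
      fix y assume "y \<in> {t..T}"
      then show "y \<in> (\<lambda>x. t + x / R) ` {0..R * (T - t)}" using R by (intro image_eqI[of _ _ "R * (y - t)"]) auto
    qed (use R in \<open>auto simp: field_simps\<close>)
    also have "(\<lambda>x. kern (R * x - R * t)) = (\<lambda>x. kern (R * (t - x)))"
    proof
      fix x show "kern (R * x - R * t) = kern (R * (t - x))"
        using kern_minus[of "R * (t - x)"] by (simp add: algebra_simps)
    qed
    finally have "((\<lambda>x. kern (R * (t - x))) has_integral (1 / R * integral {0..R * (T - t)} kern)) {t..T}" .
    from has_integral_mult_right[OF this, of R] show ?thesis using R by simp
  qed
  ultimately show ?thesis using t by (rule has_integral_combine[rotated 2])
qed

text \<open>Write \<open>g x = g t + (g x - g t)\<close>. The constant part is off by the kernel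
  mass missing from \<open>2 * pi\<close>, times \<open>B\<close>; the difference is controlled by
  the Lipschitz constant times the first absolute moment, which scales like
  \<open>1 / R\<close>.\<close>

lemma kern_approximation:
  fixes g :: "real \<Rightarrow> 'a::banach"
  assumes g: "continuous_on {0..} g" and B: "\<And>x. x \<ge> 0 \<Longrightarrow> norm (g x) \<le> B"
    and lip: "\<And>x y. 0 \<le> x \<Longrightarrow> 0 \<le> y \<Longrightarrow> norm (g x - g y) \<le> L * \<bar>x - y\<bar>"
    and R: "R \<ge> 1" and t: "t \<ge> 1"
    and V: "((\<lambda>T. integral {0..T} (\<lambda>x. (R * kern (R * (t - x))) *\<^sub>R g x)) \<longlongrightarrow> V) at_top"
  shows "norm ((2 * pi) *\<^sub>R g t - V) \<le> (224 * pi * L + 112 * B) / R"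
proof -
  define S where "S x = integral {0..x} kern" for x
  define k where "k x = R * kern (R * (t - x))" for x
  have R0: "R > 0" using R by simp
  have kc: "continuous_on A k" for A
    unfolding k_def by (intro continuous_intros continuous_on_compose2[OF continuous_on_kern[of UNIV]]) auto
  have L0: "L \<ge> 0" using order_trans[OF norm_ge_zero lip[of 0 1]] by simp
  have B0: "B \<ge> 0" using order_trans[OF norm_ge_zero B[of 0]] by simp
  have bound: "norm ((2 * pi) *\<^sub>R g t - integral {0..T} (\<lambda>x. k x *\<^sub>R g x)) \<le> 224 * pi * L / R + \<bar>2 * pi - S (R * t) - S (R * (T - t))\<bar> * B"
    if T: "T \<ge> t" for T
  proof -
    have k: "(k has_integral (S (R * t) + S (R * (T - t)))) {0..T}"
      unfolding k_def S_def using t T by (intro integral_shifted_kern R0) auto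
    have gc: "continuous_on {0..T} g" by (rule continuous_on_subset[OF g]) auto
    have "integral {0..T} (\<lambda>x. k x *\<^sub>R (g x - g t)) = integral {0..T} (\<lambda>x. k x *\<^sub>R g x - k x *\<^sub>R g t)"
      by (simp add: scaleR_diff_right)
    also have "\<dots> = integral {0..T} (\<lambda>x. k x *\<^sub>R g x) - integral {0..T} (\<lambda>x. k x *\<^sub>R g t)"
      by (intro integral_diff integrable_continuous_interval continuous_intros kc gc)
    also have "integral {0..T} (\<lambda>x. k x *\<^sub>R g t) = (S (R * t) + S (R * (T - t))) *\<^sub>R g t"
      using k by (intro integral_unique has_integral_scaleR_left)
    finally have eq: "(2 * pi) *\<^sub>R g t - integral {0..T} (\<lambda>x. k x *\<^sub>R g x)
        = (2 * pi - S (R * t) - S (R * (T - t))) *\<^sub>R g t - integral {0..T} (\<lambda>x. k x *\<^sub>R (g x - g t))"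
      by (simp add: algebra_simps)
    \<comment> \<open>The range of the arctangent has length \<open>pi\<close>, so this integral is
      at most \<open>224 * pi * L / R\<close> for every \<open>T\<close>.\<close>
    have arc: "((\<lambda>x. 224 * L / (1 + (R * (x - t))\<^sup>2)) has_integral
       (224 * L / R * arctan (R * (T - t)) - 224 * L / R * arctan (R * (0 - t)))) {0..T}"
    proof (rule fundamental_theorem_of_calculus)
      fix x :: real
      have "((\<lambda>x. 224 * L / R * arctan (R * (x - t))) has_real_derivative (224 * L / R * (inverse (1 + (R * (x - t))\<^sup>2) * R))) (at x)"
        by (rule derivative_eq_intros refl)+ simp
      also have "224 * L / R * (inverse (1 + (R * (x - t))\<^sup>2) * R) = 224 * L / (1 + (R * (x - t))\<^sup>2)"
        using R0 by (simp add: divide_inverse)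
      finally show "((\<lambda>x. 224 * L / R * arctan (R * (x - t))) has_vector_derivative 224 * L / (1 + (R * (x - t))\<^sup>2)) (at x within {0..T})"
        by (simp add: has_real_derivative_iff_has_vector_derivative has_vector_derivative_at_within)
    qed (use t T in auto)
    have "norm (integral {0..T} (\<lambda>x. k x *\<^sub>R (g x - g t))) \<le> integral {0..T} (\<lambda>x. 224 * L / (1 + (R * (x - t))\<^sup>2))"
    proof (rule integral_norm_bound_integral)
      show "(\<lambda>x. k x *\<^sub>R (g x - g t)) integrable_on {0..T}"
        by (intro integrable_continuous_interval continuous_intros kc gc)
      show "(\<lambda>x. 224 * L / (1 + (R * (x - t))\<^sup>2)) integrable_on {0..T}" using arc by (rule has_integral_integrable)
      fix x assume x: "x \<in> {0..T}"
      have "norm (k x *\<^sub>R (g x - g t)) \<le> \<bar>k x\<bar> * (L * \<bar>x - t\<bar>)"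
        using lip[of x t] x t by (simp add: mult_left_mono)
      also have "\<dots> = L * (\<bar>R * (t - x)\<bar> * \<bar>kern (R * (t - x))\<bar>)"
        using R0 by (simp add: k_def abs_mult abs_minus_commute)
      also have "\<dots> \<le> L * (224 / (1 + (R * (t - x))\<^sup>2))"
        by (intro mult_left_mono abs_kern_moment_le L0)
      also have "(R * (t - x))\<^sup>2 = (R * (x - t))\<^sup>2" by algebra
      finally show "norm (k x *\<^sub>R (g x - g t)) \<le> 224 * L / (1 + (R * (x - t))\<^sup>2)" by (simp add: mult.commute)
    qed
    also have "\<dots> = 224 * L / R * (arctan (R * (T - t)) - arctan (R * (0 - t)))"
      using integral_unique[OF arc] by (simp add: right_diff_distrib)
    also have "\<dots> \<le> 224 * L / R * pi"
      using arctan_ubound[of "R * (T - t)"] arctan_lbound[of "R * (0 - t)"] L0 R0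
      by (intro mult_left_mono) auto
    finally have i: "norm (integral {0..T} (\<lambda>x. k x *\<^sub>R (g x - g t))) \<le> 224 * pi * L / R" by (simp add: mult_ac)
    have "norm ((2 * pi - S (R * t) - S (R * (T - t))) *\<^sub>R g t) \<le> \<bar>2 * pi - S (R * t) - S (R * (T - t))\<bar> * B"
      using B[of t] t by (simp add: mult_left_mono)
    with i show ?thesis unfolding eq
      by (intro order_trans[OF norm_triangle_ineq4]) linarith
  qed
  have S: "((\<lambda>T. S (R * (T - t))) \<longlongrightarrow> pi) at_top"
  proof -
    have "filterlim (\<lambda>T. R * (T - t)) at_top at_top"
      unfolding filterlim_at_top
    proof
      fix Z :: real
      show "\<forall>\<^sub>F T in at_top. Z \<le> R * (T - t)"
        by (rule eventually_mono[OF eventually_ge_at_top[of "Z / R + t"]]) (use R0 in \<open>simp add: field_simps\<close>)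
    qed
    from filterlim_compose[OF integral_kern_tendsto this] show ?thesis by (simp add: S_def)
  qed
  have lhs: "((\<lambda>T. norm ((2 * pi) *\<^sub>R g t - integral {0..T} (\<lambda>x. k x *\<^sub>R g x))) \<longlongrightarrow> norm ((2 * pi) *\<^sub>R g t - V)) at_top"
    using V unfolding k_def by (intro tendsto_norm tendsto_diff tendsto_const)
  \<comment> \<open>The right half of the mass becomes complete as \<open>T\<close> grows; only the
    mass to the left of 0 stays missing.\<close>
  have rhs: "((\<lambda>T. 224 * pi * L / R + \<bar>2 * pi - S (R * t) - S (R * (T - t))\<bar> * B) \<longlongrightarrow> 224 * pi * L / R + \<bar>2 * pi - S (R * t) - pi\<bar> * B) at_top"
    by (intro tendsto_add tendsto_mult tendsto_rabs tendsto_diff S tendsto_const)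
  have "norm ((2 * pi) *\<^sub>R g t - V) \<le> 224 * pi * L / R + \<bar>2 * pi - S (R * t) - pi\<bar> * B"
    by (rule tendsto_le[OF _ rhs lhs]) (auto intro: eventually_mono[OF eventually_ge_at_top[of t]] bound)
  also have "\<bar>2 * pi - S (R * t) - pi\<bar> = \<bar>pi - S (R * t)\<bar>" by simp
  also have "\<dots> \<le> 112 / (R * t)" unfolding S_def using R t mult_mono[OF R t] by (intro integral_kern_tail) auto
  also have "112 / (R * t) \<le> 112 / R" using R0 t by (intro divide_left_mono) auto
  finally show ?thesis using B0 by (simp add: add_divide_distrib mult_right_mono)
qed

lemma abs_exp_diff_le:
  fixes x y :: real
  assumes "0 \<le> x" "0 \<le> y"
  shows "\<bar>exp (- x) - exp (- y)\<bar> \<le> \<bar>x - y\<bar>"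
proof -
  have *: "\<bar>exp (- u) - exp (- v)\<bar> \<le> v - u" if "0 \<le> u" "u \<le> v" for u v :: real
  proof -
    have "exp (- u) - exp (- v) = exp (- u) * (1 - exp (- (v - u)))" by (simp add: algebra_simps exp_add[symmetric])
    also have "\<dots> \<le> 1 * (v - u)"
    proof (rule mult_mono)
      show "1 - exp (- (v - u)) \<le> v - u" using exp_ge_add_one_self[of "- (v - u)"] by linarith
    qed (use that in auto)
    finally show ?thesis using that by simp
  qed
  show ?thesis using *[of x y] *[of y x] assms by (cases "x \<le> y") (auto simp: abs_minus_commute)
qed

lemma boundary_function_approximation:
  fixes f F :: "real \<Rightarrow> 'a::complex_banach"
  assumes f: "continuous_on {0..} f" and B: "\<And>x. x \<ge> 0 \<Longrightarrow> norm (f x) \<le> B"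
    and lip: "L-lipschitz_on {0..} f"
    and bf: "boundary_function f F" and R: "R \<ge> 1" and t: "t \<ge> 1"
  shows "norm ((2 * pi) *\<^sub>R f t - integral {-R..R} (\<lambda>s. scaleC (of_real (cutoff R s) * cis (s * t)) (F s)))
    \<le> (224 * pi * (L + B) + 112 * B) / R"
proof -
  have R0: "R > 0" using R by simp
  define cut where "cut s = of_real (cutoff R s) * cis (s * t)" for s
  define V where "V \<alpha> = integral UNIV (\<lambda>s. scaleC (cut s) (laplace f (of_real \<alpha> + \<i> * of_real s)))" for \<alpha>
  have B0: "B \<ge> 0" using order_trans[OF norm_ge_zero B[of 0]] by simp
  have bound: "norm ((2 * pi) *\<^sub>R (exp (- \<alpha> * t) *\<^sub>R f t) - V \<alpha>) \<le> (224 * pi * (L + B) + 112 * B) / R"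
    if \<alpha>: "0 < \<alpha>" "\<alpha> < 1" for \<alpha>
  proof (rule kern_approximation[OF _ _ _ R t])
    show "continuous_on {0..} (\<lambda>x. exp (- \<alpha> * x) *\<^sub>R f x)" by (intro continuous_intros f)
    show "norm (exp (- \<alpha> * x) *\<^sub>R f x) \<le> B" if "x \<ge> 0" for x
      using mult_mono[of "exp (- \<alpha> * x)" 1 "norm (f x)" B] that \<alpha> B[OF that] by simp
    \<comment> \<open>The damping adds at most \<open>\<alpha> * B\<close>, hence at most
      \<open>B\<close>, to the Lipschitz constant. This is the origin of
      \<open>L + B\<close>.\<close>
    show "norm (exp (- \<alpha> * x) *\<^sub>R f x - exp (- \<alpha> * y) *\<^sub>R f y) \<le> (L + B) * \<bar>x - y\<bar>" if xy: "0 \<le> x" "0 \<le> y" for x y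
    proof -
      have "exp (- \<alpha> * x) *\<^sub>R f x - exp (- \<alpha> * y) *\<^sub>R f y = exp (- \<alpha> * x) *\<^sub>R (f x - f y) + (exp (- \<alpha> * x) - exp (- \<alpha> * y)) *\<^sub>R f y"
        by (simp add: algebra_simps)
      also have "norm \<dots> \<le> norm (exp (- \<alpha> * x) *\<^sub>R (f x - f y)) + norm ((exp (- \<alpha> * x) - exp (- \<alpha> * y)) *\<^sub>R f y)"
        by (rule norm_triangle_ineq)
      also have "norm (exp (- \<alpha> * x) *\<^sub>R (f x - f y)) \<le> 1 * (L * \<bar>x - y\<bar>)"
        unfolding norm_scaleR using lipschitz_onD[OF lip, of x y] xy \<alpha>
        by (intro mult_mono) (auto simp: dist_norm)
      also have "norm ((exp (- \<alpha> * x) - exp (- \<alpha> * y)) *\<^sub>R f y) \<le> \<bar>x - y\<bar> * B"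
        unfolding norm_scaleR
      proof (rule mult_mono)
        have "\<bar>exp (- (\<alpha> * x)) - exp (- (\<alpha> * y))\<bar> \<le> \<bar>\<alpha> * x - \<alpha> * y\<bar>"
          using xy \<alpha> by (intro abs_exp_diff_le) auto
        also have "\<dots> = \<alpha> * \<bar>x - y\<bar>" using \<alpha> by (simp add: abs_mult flip: right_diff_distrib)
        also have "\<dots> \<le> 1 * \<bar>x - y\<bar>" using \<alpha> by (intro mult_right_mono) auto
        finally show "\<bar>exp (- \<alpha> * x) - exp (- \<alpha> * y)\<bar> \<le> \<bar>x - y\<bar>" by simp
      qed (use B xy B0 in auto)
      finally show ?thesis by (simp add: algebra_simps)
    qed
    show "((\<lambda>T. integral {0..T} (\<lambda>x. (R * kern (R * (t - x))) *\<^sub>R (exp (- \<alpha> * x) *\<^sub>R f x))) \<longlongrightarrow> V \<alpha>) at_top"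
      unfolding V_def cut_def by (rule laplace_cutoff_tendsto[OF f B \<alpha>(1) R0])
  qed
  have "cut \<in> Cc" unfolding cut_def using cutoff_cis_in_Cc[OF R0] .
  then have lim: "(V \<longlongrightarrow> integral UNIV (\<lambda>s. scaleC (cut s) (F s))) (at_right 0)"
    using bf unfolding boundary_function_def V_def by blast
  have "((\<lambda>\<alpha>. exp (- \<alpha> * t)) \<longlongrightarrow> exp (- 0 * t)) (at_right 0)"
    by (intro tendsto_intros)
  then have "((\<lambda>\<alpha>. norm ((2 * pi) *\<^sub>R (exp (- \<alpha> * t) *\<^sub>R f t) - V \<alpha>)) \<longlongrightarrow> norm ((2 * pi) *\<^sub>R (exp (- 0 * t) *\<^sub>R f t) - integral UNIV (\<lambda>s. scaleC (cut s) (F s)))) (at_right 0)"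
    by (intro tendsto_norm tendsto_diff tendsto_scaleR tendsto_const lim)
  moreover have "\<forall>\<^sub>F \<alpha> in at_right 0. norm ((2 * pi) *\<^sub>R (exp (- \<alpha> * t) *\<^sub>R f t) - V \<alpha>) \<le> (224 * pi * (L + B) + 112 * B) / R"
    unfolding eventually_at_right_field using bound by (intro exI[of _ 1]) auto
  ultimately have "norm ((2 * pi) *\<^sub>R (exp (- 0 * t) *\<^sub>R f t) - integral UNIV (\<lambda>s. scaleC (cut s) (F s))) \<le> (224 * pi * (L + B) + 112 * B) / R"
    by (rule tendsto_upperbound) simp
  then show ?thesis by (simp add: cut_def integral_UNIV_cutoff[OF R0])
qed

section \<open>Repeated integration by parts\<close>

text \<open>This is $(1 + 1/k)^{k+1} \<ge> e$ without division, from $1 - x \<le> e^{-x}$ at $x =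
  1/(k+1)$. It is the induction step for the factorial bound.\<close>

lemma exp_one_mult_power_le:
  fixes k :: nat
  assumes "k > 0"
  shows "exp 1 * real k ^ Suc k \<le> real (Suc k) ^ Suc k"
proof -
  have "real k / real (Suc k) \<le> exp (- (1 / real (Suc k)))"
    using exp_ge_add_one_self[of "- (1 / real (Suc k))"] by (simp add: field_simps)
  then have "real k \<le> exp (- (1 / real (Suc k))) * real (Suc k)" by (simp add: field_simps)
  then have "exp (1 / real (Suc k)) * real k \<le> exp (1 / real (Suc k)) * (exp (- (1 / real (Suc k))) * real (Suc k))"
    by (intro mult_left_mono) auto
  also have "\<dots> = real (Suc k)" by (simp add: mult.assoc[symmetric] flip: exp_add)
  finally have "(exp (1 / real (Suc k)) * real k) ^ Suc k \<le> real (Suc k) ^ Suc k"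
    by (intro power_mono) auto
  moreover have "exp (1 / real (Suc k)) ^ Suc k = exp 1"
    by (simp del: power_Suc flip: exp_of_nat_mult)
  ultimately show ?thesis by (simp only: power_mult_distrib)
qed

text \<open>It loses a factor of order $k^{1/2}$ against Stirling's formula, which is harmless
  because it will compete with an exponential gap.\<close>

lemma fact_mult_exp_le:
  assumes "k \<ge> 1"
  shows "fact k * exp (real k) \<le> exp 1 * real k ^ Suc k"
  using assms
proof (induction k rule: nat_induct_at_least)
  case (Suc k)
  have "fact (Suc k) * exp (real (Suc k)) = real (Suc k) * exp 1 * (fact k * exp (real k))"
    by (simp add: exp_add algebra_simps)
  also have "\<dots> \<le> real (Suc k) * exp 1 * (exp 1 * real k ^ Suc k)"
    using Suc by (intro mult_left_mono) auto
  also have "\<dots> \<le> real (Suc k) * exp 1 * (real (Suc k) ^ Suc k)"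
    using Suc by (intro mult_left_mono exp_one_mult_power_le) auto
  finally show ?case by (simp add: algebra_simps)
qed simp

section \<open>Oscillatory integrals and the Leibniz rule\<close>

lemma cis_has_vector_derivative:
  "((\<lambda>s. cis (s * t)) has_vector_derivative (\<i> * of_real t * cis (s * t))) (at s within A)"
proof -
  have "((\<lambda>z. exp (\<i> * of_real t * z)) has_field_derivative (\<i> * of_real t * exp (\<i> * of_real t * of_real s))) (at (of_real s))"
    by (auto intro!: derivative_eq_intros)
  from has_vector_derivative_real_field[OF this, of A] show ?thesis
    by (simp add: cis_conv_exp o_def mult_ac)
qed

lemma fourier_integral_by_parts:
  fixes G H :: "real \<Rightarrow> 'a::complex_banach"
  assumes "a \<le> b" and t: "t > 0"
    and deriv: "\<And>s. (G has_vector_derivative H s) (at s)" and H: "continuous_on {a..b} H"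
  shows "norm (integral {a..b} (\<lambda>s. scaleC (cis (s * t)) (G s)))
    \<le> (norm (G a) + norm (G b)) / t + norm (integral {a..b} (\<lambda>s. scaleC (cis (s * t)) (H s))) / t"
proof -
  define I where "I = integral {a..b} (\<lambda>s. scaleC (cis (s * t)) (G s))"
  define J where "J = integral {a..b} (\<lambda>s. scaleC (cis (s * t)) (H s))"
  have G: "continuous_on {a..b} G"
    using deriv by (intro continuous_at_imp_continuous_on ballI has_vector_derivative_continuous) blast
  have I: "((\<lambda>s. scaleC (cis (s * t)) (G s)) has_integral I) {a..b}"
    unfolding I_def by (intro integrable_integral integrable_continuous_interval continuous_intros G)
  have J: "((\<lambda>s. scaleC (cis (s * t)) (H s)) has_integral J) {a..b}"
    unfolding J_def by (intro integrable_integral integrable_continuous_interval continuous_intros H)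
  have "((\<lambda>s. scaleC (cis (s * t)) (H s) + scaleC (\<i> * of_real t * cis (s * t)) (G s)) has_integral
      (scaleC (cis (b * t)) (G b) - scaleC (cis (a * t)) (G a))) {a..b}"
    by (intro fundamental_theorem_of_calculus assms(1) bounded_bilinear.has_vector_derivative[OF bounded_bilinear_scaleC]
        cis_has_vector_derivative has_vector_derivative_at_within[OF deriv])
  moreover have "((\<lambda>s. scaleC (cis (s * t)) (H s) + scaleC (\<i> * of_real t * cis (s * t)) (G s)) has_integral
      (J + scaleC (\<i> * of_real t) I)) {a..b}"
    using has_integral_add[OF J has_integral_linear[OF I bounded_linear_scaleC_right[of "\<i> * of_real t"]]]
    by (simp add: o_def scaleC_scaleC)
  ultimately have "J + scaleC (\<i> * of_real t) I = scaleC (cis (b * t)) (G b) - scaleC (cis (a * t)) (G a)"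
    by (rule has_integral_unique[rotated])
  then have "scaleC (\<i> * of_real t) I = scaleC (cis (b * t)) (G b) - scaleC (cis (a * t)) (G a) - J"
    by (simp add: algebra_simps)
  then have "norm (scaleC (\<i> * of_real t) I) \<le> norm (scaleC (cis (b * t)) (G b)) + norm (scaleC (cis (a * t)) (G a)) + norm J"
    by (metis norm_triangle_ineq4 norm_triangle_le_diff order_trans add_right_mono)
  then have "t * norm I \<le> norm (G a) + norm (G b) + norm J"
    using t by (simp add: norm_scaleC norm_mult)
  then show ?thesis unfolding I_def[symmetric] J_def[symmetric] using t by (simp add: field_simps)
qed

lemma fourier_integral_by_parts_iterated:
  fixes G :: "nat \<Rightarrow> real \<Rightarrow> 'a::complex_banach"
  assumes ab: "a \<le> b" and t: "t > 0"
    and deriv: "\<And>j s. j < k \<Longrightarrow> (G j has_vector_derivative G (Suc j) s) (at s)"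
    and cont: "continuous_on UNIV (G k)"
  shows "norm (integral {a..b} (\<lambda>s. scaleC (cis (s * t)) (G 0 s)))
    \<le> (\<Sum>j<k. (norm (G j a) + norm (G j b)) / t ^ Suc j) + integral {a..b} (\<lambda>s. norm (G k s)) / t ^ k"
  using deriv cont
proof (induction k arbitrary: G)
  case 0
  then have c: "continuous_on {a..b} (G 0)" by (auto intro: continuous_on_subset)
  show ?case
    by (simp, intro integral_norm_bound_integral integrable_continuous_interval continuous_intros c) (simp add: norm_scaleC)
next
  case (Suc k)
  \<comment> \<open>For \<open>k = 0\<close> continuity of \<open>G 1\<close> is the hypothesis
    itself; for larger \<open>k\<close> it follows from differentiability.\<close>
  have c: "continuous_on UNIV (G (Suc 0))"
  proof (cases k)
    case 0
    then show ?thesis using Suc.prems(2) by simp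
  next
    case (Suc k')
    then show ?thesis using Suc.prems(1)[of 1]
      by (intro continuous_at_imp_continuous_on ballI has_vector_derivative_continuous) auto
  qed
  have "norm (integral {a..b} (\<lambda>s. scaleC (cis (s * t)) (G 0 s)))
      \<le> (norm (G 0 a) + norm (G 0 b)) / t + norm (integral {a..b} (\<lambda>s. scaleC (cis (s * t)) (G (Suc 0) s))) / t"
    using Suc.prems(1)[of 0] by (intro fourier_integral_by_parts ab t continuous_on_subset[OF c]) auto
  also have "norm (integral {a..b} (\<lambda>s. scaleC (cis (s * t)) (G (Suc 0) s)))
      \<le> (\<Sum>j<k. (norm (G (Suc j) a) + norm (G (Suc j) b)) / t ^ Suc j) + integral {a..b} (\<lambda>s. norm (G (Suc k) s)) / t ^ k"
    using Suc.prems by (intro Suc.IH) auto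
  finally have "norm (integral {a..b} (\<lambda>s. scaleC (cis (s * t)) (G 0 s)))
      \<le> (norm (G 0 a) + norm (G 0 b)) / t + ((\<Sum>j<k. (norm (G (Suc j) a) + norm (G (Suc j) b)) / t ^ Suc j) + integral {a..b} (\<lambda>s. norm (G (Suc k) s)) / t ^ k) / t"
    using t by (simp add: divide_right_mono)
  also have "\<dots> = (\<Sum>j<Suc k. (norm (G j a) + norm (G j b)) / t ^ Suc j) + integral {a..b} (\<lambda>s. norm (G (Suc k) s)) / t ^ Suc k"
    by (subst sum.lessThan_Suc_shift) (simp add: add_divide_distrib sum_divide_distrib mult.commute)
  finally show ?case .
qed

text \<open>Differentiating the \<open>j\<close>-th Leibniz sum yields the next one, by Pascal's
  rule. The sums therefore form the chain of derivatives required by the iterated integration by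
  parts.\<close>

lemma Leibniz_has_vector_derivative:
  fixes P :: "nat \<Rightarrow> real \<Rightarrow> real" and Fd :: "nat \<Rightarrow> real \<Rightarrow> 'a::real_normed_vector"
  assumes P: "\<And>j. (P j has_real_derivative P (Suc j) s) (at s)"
    and F: "\<And>i. i \<le> j \<Longrightarrow> (Fd i has_vector_derivative Fd (Suc i) s) (at s)"
  shows "((\<lambda>s. \<Sum>i\<le>j. real (j choose i) *\<^sub>R (P i s *\<^sub>R Fd (j - i) s)) has_vector_derivative
     (\<Sum>i\<le>Suc j. real (Suc j choose i) *\<^sub>R (P i s *\<^sub>R Fd (Suc j - i) s))) (at s)"
proof -
  define T where "T i = P i s *\<^sub>R Fd (Suc j - i) s" for i
  have "((\<lambda>s. \<Sum>i\<le>j. real (j choose i) *\<^sub>R (P i s *\<^sub>R Fd (j - i) s)) has_vector_derivative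
     (\<Sum>i\<le>j. real (j choose i) *\<^sub>R (P i s *\<^sub>R Fd (Suc (j - i)) s + P (Suc i) s *\<^sub>R Fd (j - i) s))) (at s)"
    by (intro has_vector_derivative_sum bounded_linear.has_vector_derivative[OF bounded_linear_scaleR_right]
        has_vector_derivative_scaleR P F) auto
  also have "(\<Sum>i\<le>j. real (j choose i) *\<^sub>R (P i s *\<^sub>R Fd (Suc (j - i)) s + P (Suc i) s *\<^sub>R Fd (j - i) s))
      = (\<Sum>i\<le>j. real (j choose i) *\<^sub>R T i + real (j choose i) *\<^sub>R T (Suc i))"
    by (intro sum.cong) (auto simp: T_def scaleR_add_right Suc_diff_le)
  \<comment> \<open>The range may be extended to \<open>Suc j\<close> because
    \<open>j choose Suc j\<close> is 0; after the shift both sums run over the same indices.\<close>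
  also have "\<dots> = (\<Sum>i\<le>Suc j. real (j choose i) *\<^sub>R T i) + (\<Sum>i\<le>j. real (j choose i) *\<^sub>R T (Suc i))"
    by (simp add: sum.distrib)
  also have "(\<Sum>i\<le>Suc j. real (j choose i) *\<^sub>R T i) = T 0 + (\<Sum>i\<le>j. real (j choose Suc i) *\<^sub>R T (Suc i))"
    by (subst sum.atMost_Suc_shift) simp
  also have "T 0 + (\<Sum>i\<le>j. real (j choose Suc i) *\<^sub>R T (Suc i)) + (\<Sum>i\<le>j. real (j choose i) *\<^sub>R T (Suc i))
      = T 0 + (\<Sum>i\<le>j. real (Suc j choose Suc i) *\<^sub>R T (Suc i))"
    by (simp add: sum.distrib scaleR_add_left algebra_simps)
  also have "\<dots> = (\<Sum>i\<le>Suc j. real (Suc j choose i) *\<^sub>R T i)"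
    by (subst sum.atMost_Suc_shift) simp
  finally show ?thesis unfolding T_def .
qed

text \<open>The successive derivatives of the polynomial $(1 - x^2)^2$ on the whole line. The cutoff
  itself cannot be used here, since its second derivative jumps at the endpoints.\<close>

definition quartic_deriv :: "nat \<Rightarrow> real \<Rightarrow> real" where
  "quartic_deriv j x = (if j = 0 then (1 - x\<^sup>2)\<^sup>2 else if j = 1 then 4 * x^3 - 4 * x else if j = 2 then 12 * x\<^sup>2 - 4
     else if j = 3 then 24 * x else if j = 4 then 24 else 0)"

lemma quartic_deriv: "(quartic_deriv j has_real_derivative quartic_deriv (Suc j) x) (at x)"
proof -
  consider "j = 0" | "j = 1" | "j = 2" | "j = 3" | "j = 4" | "j > 4" by linarith
  then show ?thesis
  proof cases
    case 1
    then show ?thesis unfolding quartic_deriv_def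
      by (auto intro!: derivative_eq_intros simp: power2_eq_square power3_eq_cube algebra_simps)
  qed (auto intro!: derivative_eq_intros simp: quartic_deriv_def[abs_def])
qed

text \<open>A bound independent of the order keeps the Leibniz estimates uniform when the number of
  integrations grows with $t$.\<close>

lemma abs_quartic_deriv_le:
  assumes "\<bar>x\<bar> \<le> 1"
  shows "\<bar>quartic_deriv j x\<bar> \<le> 24"
proof -
  have x2: "0 \<le> x\<^sup>2" "x\<^sup>2 \<le> 1" using assms by (auto simp: abs_square_le_1)
  then have "\<bar>1 - x\<^sup>2\<bar> \<le> 1" by linarith
  then have a: "\<bar>(1 - x\<^sup>2)\<^sup>2\<bar> \<le> 1" by (simp add: abs_square_le_1)
  have "\<bar>x^3\<bar> \<le> 1" using power_le_one[of "\<bar>x\<bar>" 3] assms by (simp add: power_abs)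
  then have b: "\<bar>4 * x^3 - 4 * x\<bar> \<le> 8" using assms by linarith
  have c: "\<bar>12 * x\<^sup>2 - 4\<bar> \<le> 8" using x2 by linarith
  show ?thesis using a b c assms unfolding quartic_deriv_def by auto
qed

text \<open>The common core of both rates: \<open>A j = 1\<close> with \<open>S j = 2 ^ j\<close>
  serves (a), and \<open>A j = fact j\<close> with \<open>S j = 3 * fact j\<close> serves (b). The
  constant 48 is 24 times two endpoints in the first term, and 24 times the length factor 2 of
  \<open>{-R..R}\<close> in the second.\<close>

lemma cutoff_integral_bound:
  fixes Fd :: "nat \<Rightarrow> real \<Rightarrow> 'a::complex_banach"
  assumes R: "R \<ge> 1" and t: "t > 0" and m: "m \<ge> 1" and C: "C \<ge> 0"
    and deriv: "\<And>j s. j < k \<Longrightarrow> (Fd j has_vector_derivative Fd (Suc j) s) (at s)"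
    and cont: "continuous_on UNIV (Fd k)"
    and bound: "\<And>j s. j \<le> k \<Longrightarrow> \<bar>s\<bar> \<le> R \<Longrightarrow> norm (Fd j s) \<le> C * A j * m ^ (j + 1)"
    and A: "\<And>j. A j \<ge> 0" and S: "\<And>j. (\<Sum>i\<le>j. real (j choose i) * A (j - i)) \<le> S j"
  shows "norm (integral {-R..R} (\<lambda>s. scaleC (of_real (cutoff R s) * cis (s * t)) (Fd 0 s)))
    \<le> 48 * C / R\<^sup>2 * (\<Sum>j<k. S j * (m / t) ^ Suc j) + 48 * C * R * m * (S k * (m / t) ^ k)"
proof -
  have R0: "R > 0" using R by simp
  define P where "P j s = quartic_deriv j (s / R) / R ^ j" for j s
  have P: "(P j has_real_derivative P (Suc j) s) (at s)" for j s
  proof -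
    have "((\<lambda>s. quartic_deriv j (s / R)) has_real_derivative quartic_deriv (Suc j) (s / R) * (1 / R)) (at s)"
      using R0 by (intro DERIV_chain2[OF quartic_deriv]) (auto intro!: derivative_eq_intros)
    from DERIV_cdivide[OF this, of "R ^ j"] show ?thesis by (simp add: P_def[abs_def] mult.commute)
  qed
  define G where "G j s = (\<Sum>i\<le>j. real (j choose i) *\<^sub>R (P i s *\<^sub>R Fd (j - i) s))" for j s
  have Gd: "(G j has_vector_derivative G (Suc j) s) (at s)" if "j < k" for j s
    unfolding G_def[abs_def] using that by (intro Leibniz_has_vector_derivative P deriv) auto
  have Fc: "continuous_on UNIV (Fd j)" if "j \<le> k" for j
  proof (cases "j = k")
    case False
    then show ?thesis using deriv[of j] that
      by (intro continuous_at_imp_continuous_on ballI has_vector_derivative_continuous) auto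
  qed (use cont in simp)
  have Pc: "continuous_on UNIV (P j)" for j
    using P by (intro continuous_at_imp_continuous_on ballI) (blast intro: DERIV_isCont)
  have Gc: "continuous_on UNIV (G k)"
    unfolding G_def[abs_def] by (intro continuous_intros Pc Fc) auto
  \<comment> \<open>The parameter \<open>q\<close> covers both uses: 24 on the whole interval and
    \<open>24 / R\<^sup>2\<close> at the endpoints. Since \<open>m \<ge> 1\<close>, all powers of
    \<open>m\<close> in the Leibniz sum are raised to the highest one.\<close>
  have gen: "norm (G j s) \<le> q * (C * m ^ (j + 1) * S j)"
    if j: "j \<le> k" and s: "\<bar>s\<bar> \<le> R" and q: "q \<ge> 0" "\<And>i. \<bar>P i s\<bar> \<le> q" for j s q
  proof -
    have "norm (G j s) \<le> (\<Sum>i\<le>j. q * (C * m ^ (j + 1)) * (real (j choose i) * A (j - i)))"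
      unfolding G_def
    proof (rule sum_norm_le)
      fix i assume i: "i \<in> {..j}"
      have "norm (Fd (j - i) s) \<le> C * A (j - i) * m ^ (j - i + 1)" using j s by (intro bound) auto
      also have "\<dots> \<le> C * A (j - i) * m ^ (j + 1)" using C A m by (intro mult_left_mono power_increasing) auto
      finally have "\<bar>P i s\<bar> * norm (Fd (j - i) s) \<le> q * (C * A (j - i) * m ^ (j + 1))"
        using q by (intro mult_mono) auto
      then have "real (j choose i) * (\<bar>P i s\<bar> * norm (Fd (j - i) s)) \<le> real (j choose i) * (q * (C * A (j - i) * m ^ (j + 1)))"
        by (intro mult_left_mono) auto
      then show "norm (real (j choose i) *\<^sub>R (P i s *\<^sub>R Fd (j - i) s)) \<le> q * (C * m ^ (j + 1)) * (real (j choose i) * A (j - i))"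
        by (simp add: abs_mult mult_ac)
    qed
    also have "\<dots> = q * (C * m ^ (j + 1)) * (\<Sum>i\<le>j. real (j choose i) * A (j - i))" by (rule sum_distrib_left[symmetric])
    also have "\<dots> \<le> q * (C * m ^ (j + 1)) * S j" using q C m by (intro mult_left_mono S) auto
    finally show ?thesis by (simp add: mult.assoc)
  qed
  have sR: "\<bar>s / R\<bar> \<le> 1" if "\<bar>s\<bar> \<le> R" for s using that R0 by (simp add: abs_divide)
  have inner: "norm (G k s) \<le> 24 * (C * m ^ (k + 1) * S k)" if s: "\<bar>s\<bar> \<le> R" for s
  proof (rule gen[OF order_refl s])
    fix i
    have "\<bar>P i s\<bar> \<le> 24 / R ^ i"
      using abs_quartic_deriv_le[OF sR[OF s], of i] R0 by (simp add: P_def abs_divide divide_right_mono)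
    also have "\<dots> \<le> 24 / 1" using R by (intro divide_left_mono) auto
    finally show "\<bar>P i s\<bar> \<le> 24" by simp
  qed simp
  \<comment> \<open>At the endpoints the factors \<open>P 0\<close> and \<open>P 1\<close> vanish,
    and every later one carries at least \<open>1 / R\<^sup>2\<close> from rescaling.\<close>
  have outer: "norm (G j s) \<le> 24 / R\<^sup>2 * (C * m ^ (j + 1) * S j)" if j: "j \<le> k" and s: "s = R \<or> s = - R" for j s
  proof (rule gen[OF j])
    show sR': "\<bar>s\<bar> \<le> R" using s R0 by auto
    fix i
    show "\<bar>P i s\<bar> \<le> 24 / R\<^sup>2"
    proof (cases "i < 2")
      case True
      then have "P i s = 0" using s R0 by (cases i) (auto simp: P_def quartic_deriv_def)
      then show ?thesis by simp
    next
      case False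
      have "\<bar>P i s\<bar> \<le> 24 / R ^ i"
        using abs_quartic_deriv_le[OF sR[OF sR'], of i] R0 by (simp add: P_def abs_divide divide_right_mono)
      also have "\<dots> \<le> 24 / R ^ 2" using R False by (intro divide_left_mono power_increasing) auto
      finally show ?thesis .
    qed
  qed simp
  have "integral {-R..R} (\<lambda>s. scaleC (of_real (cutoff R s) * cis (s * t)) (Fd 0 s)) = integral {-R..R} (\<lambda>s. scaleC (cis (s * t)) (G 0 s))"
  proof (rule integral_cong)
    fix s assume "s \<in> {-R..R}"
    then have "G 0 s = cutoff R s *\<^sub>R Fd 0 s"
      using cutoff_inside[OF R0] by (simp add: G_def P_def quartic_deriv_def)
    then show "scaleC (of_real (cutoff R s) * cis (s * t)) (Fd 0 s) = scaleC (cis (s * t)) (G 0 s)"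
      by (metis mult.commute scaleC_of_real scaleC_scaleC)
  qed
  also have "norm \<dots> \<le> (\<Sum>j<k. (norm (G j (-R)) + norm (G j R)) / t ^ Suc j) + integral {-R..R} (\<lambda>s. norm (G k s)) / t ^ k"
    using R0 by (intro fourier_integral_by_parts_iterated t Gd Gc) auto
  also have "\<dots> \<le> 48 * C / R\<^sup>2 * (\<Sum>j<k. S j * (m / t) ^ Suc j) + 48 * C * R * m * (S k * (m / t) ^ k)"
  proof (rule add_mono)
    have "(\<Sum>j<k. (norm (G j (-R)) + norm (G j R)) / t ^ Suc j) \<le> (\<Sum>j<k. (48 / R\<^sup>2 * (C * m ^ (j + 1) * S j)) / t ^ Suc j)"
    proof (rule sum_mono, rule divide_right_mono)
      fix j assume "j \<in> {..<k}"
      then have "norm (G j (-R)) + norm (G j R) \<le> 24 / R\<^sup>2 * (C * m ^ (j + 1) * S j) + 24 / R\<^sup>2 * (C * m ^ (j + 1) * S j)"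
        by (intro add_mono outer) auto
      also have "\<dots> = 48 / R\<^sup>2 * (C * m ^ (j + 1) * S j)" using R0 by (simp add: field_simps)
      finally show "norm (G j (-R)) + norm (G j R) \<le> 48 / R\<^sup>2 * (C * m ^ (j + 1) * S j)" .
    qed (use t in auto)
    also have "\<dots> = 48 * C / R\<^sup>2 * (\<Sum>j<k. S j * (m / t) ^ Suc j)"
      by (simp add: sum_distrib_left power_divide mult_ac)
    finally show "(\<Sum>j<k. (norm (G j (-R)) + norm (G j R)) / t ^ Suc j) \<le> 48 * C / R\<^sup>2 * (\<Sum>j<k. S j * (m / t) ^ Suc j)" .
    have "integral {-R..R} (\<lambda>s. norm (G k s)) \<le> integral {-R..R} (\<lambda>s. 24 * (C * m ^ (k + 1) * S k))"
      using inner by (intro integral_le integrable_continuous_interval continuous_intros continuous_on_subset[OF Gc]) (auto simp: abs_le_iff)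
    also have "\<dots> = 2 * R * (24 * (C * m ^ (k + 1) * S k))" using R0 by simp
    finally have "integral {-R..R} (\<lambda>s. norm (G k s)) / t ^ k \<le> 2 * R * (24 * (C * m ^ (k + 1) * S k)) / t ^ k"
      using t by (intro divide_right_mono) auto
    also have "\<dots> = 48 * C * R * m * (S k * (m / t) ^ k)" by (simp add: power_divide mult_ac)
    finally show "integral {-R..R} (\<lambda>s. norm (G k s)) / t ^ k \<le> 48 * C * R * m * (S k * (m / t) ^ k)" .
  qed
  finally show ?thesis .
qed

section \<open>Rates of decay\<close>

text \<open>\<open>inv_into\<close> is meaningful only on the range, so \<open>c * t\<close> is
  first placed there by the intermediate value theorem. Once \<open>c * t\<close> exceeds
  \<open>N 1\<close>, monotonicity forces the preimage above 1.\<close>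

lemma eventually_inv_into_at_top:
  fixes N :: "real \<Rightarrow> real"
  assumes cont: "continuous_on {0..} N" and mono: "mono_on {0..} N"
    and unbounded: "\<And>Y. \<exists>x\<ge>0. Y \<le> N x" and c: "c > 0"
  shows "\<forall>\<^sub>F t in at_top. 1 \<le> inv_into {0..} N (c * t) \<and> N (inv_into {0..} N (c * t)) = c * t"
proof (rule eventually_mono[OF eventually_gt_at_top[of "N 1 / c"]])
  fix t assume "N 1 / c < t"
  then have t: "N 1 < c * t" using c by (simp add: field_simps)
  obtain x where x: "x \<ge> 0" "c * t \<le> N x" using unbounded by blast
  have "N 0 \<le> N 1" by (rule mono_onD[OF mono]) auto
  then have "\<exists>y. 0 \<le> y \<and> y \<le> x \<and> N y = c * t"
    using t x by (intro IVT' continuous_on_subset[OF cont]) auto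
  then have im: "c * t \<in> N ` {0..}" by force
  define r where "r = inv_into {0..} N (c * t)"
  have r: "N r = c * t" "r \<ge> 0"
    using f_inv_into_f[OF im] inv_into_into[OF im] by (auto simp: r_def)
  moreover have "1 \<le> r"
  proof (rule ccontr)
    assume "\<not> 1 \<le> r"
    then have "N r \<le> N 1" using r by (intro mono_onD[OF mono]) auto
    then show False using r t by simp
  qed
  ultimately show "1 \<le> inv_into {0..} N (c * t) \<and> N (inv_into {0..} N (c * t)) = c * t" by (simp add: r_def)
qed

lemma admissible_MD:
  assumes "admissible_M M"
  shows "continuous_on {0..} M" "mono_on {0..} M" "\<And>R. R \<ge> 0 \<Longrightarrow> M R \<ge> 1"
  using assms by (auto simp: admissible_M_def)

lemma Mk_inverse:
  assumes M: "admissible_M M" and k: "k \<ge> 1" and c: "c > 0"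
  shows "\<forall>\<^sub>F t in at_top. 1 \<le> inv_into {0..} (Mk M k) (c * t) \<and> Mk M k (inv_into {0..} (Mk M k) (c * t)) = c * t"
proof (rule eventually_inv_into_at_top[OF _ _ _ c])
  note MD = admissible_MD[OF M]
  have pos: "0 < (1 + R)\<^sup>2 * M R" if "R \<ge> 0" for R
    using that MD(3)[OF that] by (intro mult_pos_pos) auto
  show "continuous_on {0..} (Mk M k)"
    unfolding Mk_def by (intro continuous_intros MD(1)) (use pos in force)
  show "mono_on {0..} (Mk M k)"
  proof (rule mono_onI)
    fix r s :: real assume rs: "r \<in> {0..}" "s \<in> {0..}" "r \<le> s"
    have Mrs: "M r \<le> M s" using mono_onD[OF MD(2)] rs by auto
    have "((1 + r)\<^sup>2 * M r) powr (1 / real k) \<le> ((1 + s)\<^sup>2 * M s) powr (1 / real k)"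
      using rs Mrs MD(3)[of r] MD(3)[of s] pos[of r]
      by (intro powr_mono2 mult_mono power_mono) auto
    then show "Mk M k r \<le> Mk M k s"
      unfolding Mk_def using rs Mrs MD(3)[of r] MD(3)[of s] by (intro mult_mono) auto
  qed
  fix Y :: real
  \<comment> \<open>The witness is \<open>Z ^ k\<close>: the exponent \<open>1 / k\<close> in
    \<open>Mk\<close> undoes the power. Replacing \<open>Y\<close> by \<open>Z \<ge> 1\<close> makes
    this valid for negative \<open>Y\<close> too.\<close>
  define Z where "Z = max 1 Y"
  have Z: "Z \<ge> 1" "Y \<le> Z" by (auto simp: Z_def)
  have x0: "Z ^ k \<ge> 0" using Z by simp
  have "Z ^ k \<le> (1 + Z ^ k)\<^sup>2" using x0 by (simp add: power2_eq_square algebra_simps)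
  also have "\<dots> \<le> (1 + Z ^ k)\<^sup>2 * M (Z ^ k)" using mult_left_mono[OF MD(3)[OF x0], of "(1 + Z ^ k)\<^sup>2"] by simp
  finally have "(Z ^ k) powr (1 / real k) \<le> ((1 + Z ^ k)\<^sup>2 * M (Z ^ k)) powr (1 / real k)"
    using x0 by (intro powr_mono2) auto
  moreover have "(Z ^ k) powr (1 / real k) = Z"
    using Z k by (simp add: powr_powr flip: powr_realpow)
  ultimately have "1 * Z \<le> Mk M k (Z ^ k)"
    unfolding Mk_def using Z MD(3)[OF x0] by (intro mult_mono) auto
  then show "\<exists>x\<ge>0. Y \<le> Mk M k x" using Z x0 by (intro exI[of _ "Z ^ k"]) auto
qed

lemma Mlog_inverse:
  assumes M: "admissible_M M" and c: "c > 0"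
  shows "\<forall>\<^sub>F t in at_top. 1 \<le> inv_into {0..} (Mlog M) (c * t) \<and> Mlog M (inv_into {0..} (Mlog M) (c * t)) = c * t"
proof (rule eventually_inv_into_at_top[OF _ _ _ c])
  note MD = admissible_MD[OF M]
  have M0: "M R > 0" if "R \<ge> 0" for R using MD(3)[OF that] by linarith
  show "continuous_on {0..} (Mlog M)"
    unfolding Mlog_def by (intro continuous_intros MD(1)) (use M0 in force)+
  show "mono_on {0..} (Mlog M)"
  proof (rule mono_onI)
    fix r s :: real assume rs: "r \<in> {0..}" "s \<in> {0..}" "r \<le> s"
    have Mrs: "M r \<le> M s" using mono_onD[OF MD(2)] rs by auto
    then show "Mlog M r \<le> Mlog M s"
      unfolding Mlog_def using rs MD(3)[of r] MD(3)[of s] by (intro mult_mono add_mono) auto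
  qed
  fix Y :: real
  have x0: "exp Y \<ge> 0" by simp
  have "Y = ln (exp Y)" by simp
  also have "\<dots> \<le> ln (1 + exp Y)" by (subst ln_le_cancel_iff) (auto intro: add_pos_pos)
  finally have "Y \<le> ln (1 + exp Y) + ln (M (exp Y))" using MD(3)[OF x0] by (simp add: add_increasing2)
  also have "\<dots> \<le> Mlog M (exp Y)"
    unfolding Mlog_def using mult_right_mono[OF MD(3)[OF x0], of "ln (1 + exp Y) + ln (M (exp Y))"] MD(3)[OF x0] by simp
  finally show "\<exists>x\<ge>0. Y \<le> Mlog M x" using x0 by blast
qed

theorem theorem2p1:
  fixes f F :: "real \<Rightarrow> 'a::complex_banach"
  assumes "bounded (f ` {0..})"
    and "continuous_on {0..} f"
    and "\<exists>L. L-lipschitz_on {0..} f"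
    and "boundary_function f F"
  shows "(f \<longlongrightarrow> 0) at_top
    \<and> (\<forall>M. admissible_M M \<longrightarrow>
         (\<forall>(k::nat) (Fd::nat \<Rightarrow> real \<Rightarrow> 'a) C.
            k \<ge> 1 \<and> Fd 0 = F
            \<and> (\<forall>j<k. \<forall>s. (Fd j has_vector_derivative Fd (Suc j) s) (at s))
            \<and> continuous_on UNIV (Fd k)
            \<and> C > 0 \<and> (\<forall>s. \<forall>j\<le>k. norm (Fd j s) \<le> C * M \<bar>s\<bar> ^ (j + 1))
            \<longrightarrow> (\<forall>c>0. (\<lambda>t. norm (f t)) \<in> O[at_top](\<lambda>t. 1 / inv_into {0..} (Mk M k) (c * t))))
       \<and> (\<forall>(Fd::nat \<Rightarrow> real \<Rightarrow> 'a) C.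
            Fd 0 = F
            \<and> (\<forall>j. \<forall>s. (Fd j has_vector_derivative Fd (Suc j) s) (at s))
            \<and> C > 0 \<and> (\<forall>s. \<forall>j. norm (Fd j s) \<le> C * fact j * M \<bar>s\<bar> ^ (j + 1))
            \<longrightarrow> (\<forall>c. 0 < c \<and> c < 1/2 \<longrightarrow>
                  (\<lambda>t. norm (f t)) \<in> O[at_top](\<lambda>t. 1 / inv_into {0..} (Mlog M) (c * t)))))"
proof -
  obtain B where B: "\<And>x. x \<ge> 0 \<Longrightarrow> norm (f x) \<le> B"
    using assms(1) unfolding bounded_iff by auto
  obtain L where lip: "L-lipschitz_on {0..} f" using assms(3) by blast
  have L0: "L \<ge> 0" using lipschitz_on_nonneg[OF lip] .
  have B0: "B \<ge> 0" using order_trans[OF norm_ge_zero B[of 0]] by simp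
  define D where "D = 224 * pi * (L + B) + 112 * B"
  have D0: "D \<ge> 0" using L0 B0 by (simp add: D_def)
  define I where "I R t = integral {-R..R} (\<lambda>s. scaleC (of_real (cutoff R s) * cis (s * t)) (F s))" for R t
  have approx: "norm (f t) \<le> D / R + norm (I R t)" if "R \<ge> 1" "t \<ge> 1" for R t
  proof -
    have "norm (f t) \<le> (2 * pi) * norm (f t)"
      using mult_right_mono[of 1 "2 * pi" "norm (f t)"] pi_ge_two by simp
    also have "\<dots> = norm ((2 * pi) *\<^sub>R f t)" by simp
    also have "\<dots> \<le> norm ((2 * pi) *\<^sub>R f t - I R t) + norm (I R t)"
      using norm_triangle_sub[of "(2 * pi) *\<^sub>R f t" "I R t"] by simp
    also have "norm ((2 * pi) *\<^sub>R f t - I R t) \<le> D / R"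
      unfolding I_def D_def by (rule boundary_function_approximation[OF assms(2) B lip assms(4) that])
    finally show ?thesis by simp
  qed
  \<comment> \<open>Taking the radius \<open>\<rho> t\<close> in \<open>approx\<close> makes its
    first term of the desired order, so each rate reduces to the same order for the cutoff
    integral.\<close>
  have bigo: "(\<lambda>t. norm (f t)) \<in> O[at_top](\<lambda>t. 1 / \<rho> t)"
    if "\<forall>\<^sub>F t in at_top. \<rho> t \<ge> 1 \<and> norm (I (\<rho> t) t) \<le> K / \<rho> t" for \<rho> K
  proof (rule bigoI[of _ "D + K"])
    show "\<forall>\<^sub>F t in at_top. norm (norm (f t)) \<le> (D + K) * norm (1 / \<rho> t)"
      using that eventually_ge_at_top[of "1::real"]
    proof eventually_elim
      case (elim t)
      then show ?case using approx[of "\<rho> t" t] by (simp add: add_divide_distrib)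
    qed
  qed
  have "(f \<longlongrightarrow> 0) at_top"
    unfolding tendsto_iff dist_norm
  proof (intro allI impI)
    fix \<epsilon> :: real assume \<epsilon>: "\<epsilon> > 0"
    \<comment> \<open>The radius is fixed first to make \<open>D / R\<close> small; only then does
      \<open>t\<close> tend to infinity.\<close>
    define R where "R = max 1 (2 * D / \<epsilon> + 1)"
    have R: "R \<ge> 1" "R > 2 * D / \<epsilon>" by (auto simp: R_def)
    have R0: "R > 0" using R by simp
    have DR: "D / R < \<epsilon> / 2" using R \<epsilon> R0 by (simp add: field_simps)
    have Fi: "F integrable_on {-R..R}" "(\<lambda>s. norm (F s)) integrable_on {-R..R}"
      using assms(4) unfolding boundary_function_def by auto
    define G where "G s = cutoff R s *\<^sub>R F s" for s
    have cR: "continuous_on {-R..R} (cutoff R)" by (rule continuous_on_cutoff[OF R0])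
    have G: "G integrable_on {-R..R}"
      unfolding G_def by (rule integrable_on_continuous_scaleR[OF Fi cR])
    have "(\<lambda>s. \<bar>cutoff R s\<bar> *\<^sub>R norm (F s)) integrable_on {-R..R}"
      using Fi(2) by (intro integrable_on_continuous_scaleR continuous_intros cR) auto
    then have nG: "(\<lambda>s. norm (G s)) integrable_on {-R..R}" by (simp add: G_def)
    \<comment> \<open>The Riemann--Lebesgue lemma is available for real multipliers, so
      \<open>cis\<close> is split into cosine and sine.\<close>
    have split: "I R t = integral {-R..R} (\<lambda>s. cos (t * s) *\<^sub>R G s) + scaleC \<i> (integral {-R..R} (\<lambda>s. sin (t * s) *\<^sub>R G s))" for t
    proof -
      have c: "(\<lambda>s. cos (t * s) *\<^sub>R G s) integrable_on {-R..R}" and s: "(\<lambda>s. sin (t * s) *\<^sub>R G s) integrable_on {-R..R}"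
        using G nG by (auto intro!: integrable_on_continuous_scaleR continuous_intros)
      have "I R t = integral {-R..R} (\<lambda>s. cos (t * s) *\<^sub>R G s + scaleC \<i> (sin (t * s) *\<^sub>R G s))"
        unfolding I_def
      proof (rule integral_cong)
        fix s
        have "scaleC (of_real (cutoff R s) * cis (s * t)) (F s) = scaleC (cis (s * t)) (G s)"
          unfolding G_def by (metis mult.commute scaleC_of_real scaleC_scaleC)
        then show "scaleC (of_real (cutoff R s) * cis (s * t)) (F s) = cos (t * s) *\<^sub>R G s + scaleC \<i> (sin (t * s) *\<^sub>R G s)"
          by (simp add: scaleC_cis mult.commute)
      qed
      also have "\<dots> = integral {-R..R} (\<lambda>s. cos (t * s) *\<^sub>R G s) + integral {-R..R} (\<lambda>s. scaleC \<i> (sin (t * s) *\<^sub>R G s))"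
        using integrable_linear[OF s bounded_linear_scaleC_right[of \<i>]] c by (intro integral_add) (auto simp: o_def)
      also have "integral {-R..R} (\<lambda>s. scaleC \<i> (sin (t * s) *\<^sub>R G s)) = scaleC \<i> (integral {-R..R} (\<lambda>s. sin (t * s) *\<^sub>R G s))"
        using integral_linear[OF s bounded_linear_scaleC_right[of \<i>]] by (simp add: o_def)
      finally show ?thesis .
    qed
    have "((\<lambda>t. I R t) \<longlongrightarrow> 0 + scaleC \<i> 0) at_top"
      unfolding split
      by (intro tendsto_add bounded_linear.tendsto[OF bounded_linear_scaleC_right] Riemann_Lebesgue_cos_sin G nG)
    then have "((\<lambda>t. I R t) \<longlongrightarrow> 0) at_top"
      by (simp add: bounded_bilinear.zero_right[OF bounded_bilinear_scaleC])
    then have "\<forall>\<^sub>F t in at_top. dist (I R t) 0 < \<epsilon> / 2" using \<epsilon> by (intro tendstoD) auto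
    with eventually_ge_at_top[of "1::real"] show "\<forall>\<^sub>F t in at_top. norm (f t - 0) < \<epsilon>"
    proof eventually_elim
      case (elim t)
      then have "norm (I R t) < \<epsilon> / 2" by simp
      then have "norm (f t) < \<epsilon>" using approx[OF R(1) elim(1)] DR by linarith
      then show ?case by simp
    qed
  qed
  moreover have "(\<lambda>t. norm (f t)) \<in> O[at_top](\<lambda>t. 1 / inv_into {0..} (Mk M k) (c * t))"
    if M: "admissible_M M" and k: "k \<ge> 1" and F0: "Fd 0 = F"
      and deriv: "\<forall>j<k. \<forall>s. (Fd j has_vector_derivative Fd (Suc j) s) (at s)"
      and cont: "continuous_on UNIV (Fd k)" and C: "C > 0"
      and bound: "\<forall>s. \<forall>j\<le>k. norm (Fd j s) \<le> C * M \<bar>s\<bar> ^ (j + 1)" and c: "c > 0"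
    for M k c C and Fd :: "nat \<Rightarrow> real \<Rightarrow> 'a"
  proof -
    note MD = admissible_MD[OF M]
    \<comment> \<open>The first summand bounds the boundary terms through
      \<open>m / t \<le> c\<close>, the second one the remaining integral.\<close>
    define K where "K = 48 * C * (\<Sum>j<k. 2 ^ j * c ^ Suc j) + 48 * C * 2 ^ k * c ^ k"
    have K: "norm (I R t) \<le> K / R" if R: "R \<ge> 1" and MR: "Mk M k R = c * t" for R t
    proof -
      define m where "m = M R"
      have m: "m \<ge> 1" using MD(3) R by (simp add: m_def)
      define b where "b = (1 + R)\<^sup>2 * m"
      have b: "b \<ge> 1" unfolding b_def using R m mult_mono[of 1 "(1 + R)\<^sup>2" 1 m] by (simp add: one_le_power)
      have ct: "c * t = m * b powr (1 / real k)" using MR by (simp add: Mk_def m_def b_def)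
      have "1 \<le> b powr (1 / real k)" using b by (simp add: ge_one_powr_ge_zero)
      \<comment> \<open>The factor \<open>b powr (1 / real k)\<close> is at least 1; dropping it
        keeps \<open>m / t\<close>, and with it the boundary terms, bounded.\<close>
      then have mct: "m \<le> c * t" unfolding ct using m mult_left_mono[of 1 "b powr (1 / real k)" m] by simp
      then have t: "t > 0" using m c by (metis less_le_trans zero_less_one zero_less_mult_pos order_less_le_trans)
      have mt: "m / t \<le> c" using mct t by (simp add: field_simps)
      have mt0: "m / t \<ge> 0" using m t by simp
      have "(c * t) ^ k = m ^ k * b"
        unfolding ct power_mult_distrib using b k by (simp add: powr_powr flip: powr_realpow)
      then have bmt: "b * (m / t) ^ k = c ^ k" using t by (simp add: power_divide power_mult_distrib field_simps)
      have "R\<^sup>2 * m \<le> b" unfolding b_def using R m by (intro mult_right_mono power_mono) auto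
      then have "R\<^sup>2 * m * (m / t) ^ k \<le> c ^ k" unfolding bmt[symmetric] using mt0 by (intro mult_right_mono) auto
      then have main: "R * m * (m / t) ^ k \<le> c ^ k / R" using R by (simp add: field_simps power2_eq_square)
      have "norm (I R t) \<le> 48 * C / R\<^sup>2 * (\<Sum>j<k. 2 ^ j * (m / t) ^ Suc j) + 48 * C * R * m * (2 ^ k * (m / t) ^ k)"
        unfolding I_def F0[symmetric]
      proof (rule cutoff_integral_bound[where A = "\<lambda>_. 1"])
        show "norm (Fd j s) \<le> C * 1 * m ^ (j + 1)" if "j \<le> k" "\<bar>s\<bar> \<le> R" for j s
        proof -
          have "norm (Fd j s) \<le> C * M \<bar>s\<bar> ^ (j + 1)" using bound that by blast
          also have "M \<bar>s\<bar> \<le> m" unfolding m_def using that R by (intro mono_onD[OF MD(2)]) auto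
          then have "C * M \<bar>s\<bar> ^ (j + 1) \<le> C * m ^ (j + 1)"
            using C MD(3)[of "\<bar>s\<bar>"] by (intro mult_left_mono power_mono) auto
          finally show ?thesis by simp
        qed
        show "(\<Sum>i\<le>j. real (j choose i) * 1) \<le> 2 ^ j" for j
          using choose_row_sum[of j] by (simp flip: of_nat_sum)
      qed (use R t m C deriv cont in auto)
      also have "48 * C / R\<^sup>2 * (\<Sum>j<k. 2 ^ j * (m / t) ^ Suc j) \<le> 48 * C / R * (\<Sum>j<k. 2 ^ j * c ^ Suc j)"
      proof (rule mult_mono)
        show "48 * C / R\<^sup>2 \<le> 48 * C / R" using C R self_le_power[of R 2] by (intro divide_left_mono) auto
        show "(\<Sum>j<k. 2 ^ j * (m / t) ^ Suc j) \<le> (\<Sum>j<k. 2 ^ j * c ^ Suc j)"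
          using mt mt0 by (intro sum_mono mult_left_mono power_mono) auto
        show "0 \<le> (\<Sum>j<k. 2 ^ j * (m / t) ^ Suc j)" using mt0 by (intro sum_nonneg mult_nonneg_nonneg zero_le_power) auto
      qed (use C R in auto)
      also have "48 * C * R * m * (2 ^ k * (m / t) ^ k) = 48 * C * 2 ^ k * (R * m * (m / t) ^ k)" by simp
      also have "\<dots> \<le> 48 * C * 2 ^ k * (c ^ k / R)" using C main by (intro mult_left_mono) auto
      finally show ?thesis by (simp add: K_def add_divide_distrib)
    qed
    show ?thesis
      by (rule bigo[where K = K], rule eventually_mono[OF Mk_inverse[OF M k c]]) (use K in blast)
  qed
  moreover have "(\<lambda>t. norm (f t)) \<in> O[at_top](\<lambda>t. 1 / inv_into {0..} (Mlog M) (c * t))"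
    if M: "admissible_M M" and F0: "Fd 0 = F"
      and deriv: "\<forall>j. \<forall>s. (Fd j has_vector_derivative Fd (Suc j) s) (at s)" and C: "C > 0"
      and bound: "\<forall>s. \<forall>j. norm (Fd j s) \<le> C * fact j * M \<bar>s\<bar> ^ (j + 1)" and c: "0 < c" "c < 1/2"
    for M c C and Fd :: "nat \<Rightarrow> real \<Rightarrow> 'a"
  proof -
    note MD = admissible_MD[OF M]
    \<comment> \<open>The exponential gap between the gain $e^{-y/c}$ and the cost $e^{2y}$; it is
      positive exactly when $c < 1/2$.\<close>
    define \<delta> where "\<delta> = 1 / c - 2"
    have \<delta>: "\<delta> > 0" using c by (simp add: \<delta>_def field_simps)
    define K where "K = 48 * C * 3 + 48 * C * 3 * (exp 2 / (c * \<delta>))"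
    have K: "norm (I R t) \<le> K / R" if R: "R \<ge> 1" and MR: "Mlog M R = c * t" for R t
    proof -
      define m where "m = M R"
      have m: "m \<ge> 1" using MD(3) R by (simp add: m_def)
      \<comment> \<open>With this \<open>y\<close>, the equation for \<open>R\<close> becomes
        \<open>c * t = m * y\<close>, and \<open>exp y\<close> dominates both \<open>R\<close> and
        \<open>R * m\<close>.\<close>
      define y where "y = ln (1 + R) + ln m"
      have expy: "exp y = (1 + R) * m" using R m by (simp add: y_def exp_add)
      \<comment> \<open>Together with \<open>c < 1/2\<close> this gives
        \<open>y / c \<ge> 1\<close>, hence at least one integration by parts.\<close>
      have y: "y > 1/2"
      proof -
        have "ln 2 \<le> ln (1 + R)" using R by (subst ln_le_cancel_iff) auto
        moreover have "ln 2 > (1/2 :: real)" using ln2_ge_two_thirds by linarith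
        moreover have "ln m \<ge> 0" using m by simp
        ultimately show ?thesis unfolding y_def by linarith
      qed
      have ct: "c * t = m * y" using MR by (simp add: Mlog_def m_def y_def)
      have "c * t > 0" unfolding ct using m y by (intro mult_pos_pos) auto
      then have t: "t > 0" using c by (simp add: zero_less_mult_iff)
      have tm: "t / m = y / c" using ct c m by (simp add: field_simps)
      have "1 \<le> y / c" using y c by (simp add: field_simps)
      \<comment> \<open>Since \<open>y / c = t / m\<close>, this index minimises
        \<open>fact k * (m / t) ^ k\<close>: passing from \<open>k - 1\<close> to \<open>k\<close>
        multiplies by \<open>k * m / t\<close>, which is at most 1 up to here.\<close>
      define k where "k = nat \<lfloor>y / c\<rfloor>"
      have k1: "k \<ge> 1" using \<open>1 \<le> y / c\<close> by (simp add: k_def le_nat_iff le_floor_iff)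
      have k2: "real k \<le> y / c" "y / c < real k + 1" using \<open>1 \<le> y / c\<close> by (auto simp: k_def)
      have mt: "m / t \<le> 1 / real k"
      proof -
        have "m / t = 1 / (t / m)" by simp
        also have "\<dots> \<le> 1 / real k" unfolding tm using k1 k2 by (intro frac_le) auto
        finally show ?thesis .
      qed
      have mt0: "m / t \<ge> 0" using m t by simp
      \<comment> \<open>Each of the \<open>k\<close> boundary terms is at most \<open>3 / k\<close>,
        so their number does not matter although it grows with \<open>t\<close>.\<close>
      have low: "3 * fact j * (m / t) ^ Suc j \<le> 3 / real k" if "j < k" for j
      proof -
        have "fact j \<le> real (j ^ j)" by (rule fact_le_power)
        also have "\<dots> \<le> real k ^ j" using that by (simp add: power_mono)
        finally have "fact j * (m / t) ^ Suc j \<le> real k ^ j * (1 / real k) ^ Suc j"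
          using mt mt0 by (intro mult_mono power_mono zero_le_power) auto
        also have "\<dots> = 1 / real k" using k1 by (simp add: power_one_over field_simps)
        finally show ?thesis by simp
      qed
      \<comment> \<open>One factor \<open>exp 1\<close> comes from the factorial bound and the other
        from rounding: \<open>k > y / c - 1\<close>.\<close>
      have top: "fact k * (m / t) ^ k \<le> exp 2 * (y / c) * exp (- (y / c))"
      proof -
        have "fact k * (m / t) ^ k \<le> fact k * (1 / real k) ^ k"
          using mt mt0 by (intro mult_left_mono power_mono) auto
        also have "\<dots> = fact k * exp (real k) * exp (- real k) / real k ^ k"
          by (simp add: power_one_over exp_minus field_simps)
        also have "\<dots> \<le> (exp 1 * real k ^ Suc k) * exp (- real k) / real k ^ k"
          by (intro divide_right_mono mult_right_mono fact_mult_exp_le k1) auto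
        also have "\<dots> = exp 1 * real k * exp (- real k)" using k1 by simp
        also have "\<dots> \<le> exp 1 * (y / c) * exp (1 - y / c)"
          using k2 y c by (intro mult_mono) auto
        also have "\<dots> = exp 2 * (y / c) * exp (- (y / c))" by (simp add: exp_diff exp_minus field_simps flip: exp_add)
        finally show ?thesis .
      qed
      \<comment> \<open>Two factors \<open>exp y\<close> absorb \<open>R * (R * m)\<close>: one
        factor \<open>R\<close> comes from the integral over \<open>{-R..R}\<close>, the other from
        the target \<open>1 / R\<close>.\<close>
      have "R * 1 \<le> (1 + R) * m" "R * m \<le> (1 + R) * m" using R m by (intro mult_mono; simp)+
      then have "R * (R * m) \<le> exp y * exp y"
        unfolding expy using R m by (intro mult_mono) auto
      from mult_mono[OF this top]
      have "R * (R * m) * (fact k * (m / t) ^ k) \<le> (exp y * exp y) * (exp 2 * (y / c) * exp (- (y / c)))"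
        using mt0 by simp
      also have "\<dots> = exp 2 / c * (y * exp (- (\<delta> * y)))"
      proof -
        have "exp y * exp y * exp (- (y / c)) = exp (- (\<delta> * y))"
          using c by (simp add: \<delta>_def algebra_simps flip: exp_add)
        then show ?thesis by (simp add: mult_ac)
      qed
      \<comment> \<open>The linear factor \<open>y\<close> left over from the crude factorial bound
        is absorbed by the gap.\<close>
      also have "\<dots> \<le> exp 2 / c * (1 / \<delta>)"
      proof (rule mult_left_mono)
        have "\<delta> * y \<le> exp (\<delta> * y)" using exp_ge_add_one_self[of "\<delta> * y"] by linarith
        then show "y * exp (- (\<delta> * y)) \<le> 1 / \<delta>" using \<delta> by (simp add: exp_minus field_simps)
      qed (use c in simp)
      finally have "R * m * (fact k * (m / t) ^ k) * R \<le> exp 2 / (c * \<delta>)" by (simp add: mult_ac)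
      then have main: "R * m * (fact k * (m / t) ^ k) \<le> exp 2 / (c * \<delta>) / R"
        using R by (subst pos_le_divide_eq) auto
      have "norm (I R t) \<le> 48 * C / R\<^sup>2 * (\<Sum>j<k. 3 * fact j * (m / t) ^ Suc j) + 48 * C * R * m * (3 * fact k * (m / t) ^ k)"
        unfolding I_def F0[symmetric]
      proof (rule cutoff_integral_bound[where A = fact])
        show "norm (Fd j s) \<le> C * fact j * m ^ (j + 1)" if "\<bar>s\<bar> \<le> R" for j s
        proof -
          have "norm (Fd j s) \<le> C * fact j * M \<bar>s\<bar> ^ (j + 1)" using bound by blast
          also have "M \<bar>s\<bar> \<le> m" unfolding m_def using that R by (intro mono_onD[OF MD(2)]) auto
          then have "C * fact j * M \<bar>s\<bar> ^ (j + 1) \<le> C * fact j * m ^ (j + 1)"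
            using C MD(3)[of "\<bar>s\<bar>"] by (intro mult_left_mono power_mono) auto
          finally show ?thesis .
        qed
        \<comment> \<open>After division by \<open>fact j\<close> this is a partial sum of the
          exponential series at 1, and $e \<le> 3$.\<close>
        show "(\<Sum>i\<le>j. real (j choose i) * fact (j - i)) \<le> 3 * fact j" for j
        proof -
          have "(\<Sum>i\<le>j. real (j choose i) * fact (j - i)) = fact j * (\<Sum>i\<le>j. 1 / fact i)"
            by (simp add: sum_distrib_left binomial_fact field_simps)
          also have "(\<Sum>i\<le>j. 1 / fact i) \<le> exp (1::real)"
          proof -
            have "(\<Sum>i\<in>{..j}. 1 ^ i /\<^sub>R fact i) \<le> (\<Sum>i. 1 ^ i /\<^sub>R fact i :: real)"
              by (rule sum_le_suminf[OF summable_exp_generic]) auto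
            then show ?thesis by (simp add: exp_def divide_inverse)
          qed
          also have "exp (1::real) \<le> 3" by (rule exp_le)
          finally show ?thesis by (simp add: mult.commute)
        qed
        show "continuous_on UNIV (Fd k)"
          using deriv by (intro continuous_at_imp_continuous_on ballI has_vector_derivative_continuous) auto
      qed (use R t m C deriv in auto)
      also have "48 * C / R\<^sup>2 * (\<Sum>j<k. 3 * fact j * (m / t) ^ Suc j) \<le> 48 * C / R * 3"
      proof (rule mult_mono)
        show "48 * C / R\<^sup>2 \<le> 48 * C / R" using C R self_le_power[of R 2] by (intro divide_left_mono) auto
        have "(\<Sum>j<k. 3 * fact j * (m / t) ^ Suc j) \<le> (\<Sum>j<k. 3 / real k)" using low by (intro sum_mono) auto
        also have "\<dots> = 3" using k1 by simp
        finally show "(\<Sum>j<k. 3 * fact j * (m / t) ^ Suc j) \<le> 3" .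
        show "0 \<le> (\<Sum>j<k. 3 * fact j * (m / t) ^ Suc j)" using mt0 by (intro sum_nonneg mult_nonneg_nonneg zero_le_power) auto
      qed (use C R in auto)
      also have "48 * C * R * m * (3 * fact k * (m / t) ^ k) = 48 * C * 3 * (R * m * (fact k * (m / t) ^ k))" by simp
      also have "\<dots> \<le> 48 * C * 3 * (exp 2 / (c * \<delta>) / R)" using C main by (intro mult_left_mono) auto
      finally show ?thesis by (simp add: K_def add_divide_distrib)
    qed
    show ?thesis
      by (rule bigo[where K = K], rule eventually_mono[OF Mlog_inverse[OF M c(1)]]) (use K in blast)
  qed
  ultimately show ?thesis by blast
qed

end
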